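(* Let $\Delta:=\{-1,1\}^{\mathbb{N}}$ be the Cantor set. The Banach algebra $L(C(\Delta))$ of bounded linear operators on the space $C(\Delta)$ of continuous functions on $\Delta$ contains a continuum of small closed ideals; that is, there is a family of cardinality $2^{\aleph_0}$ of pairwise distinct small closed ideals in $L(C(\Delta))$.
   Context: $C(\Delta)$ is the Banach space of scalar-valued (real or complex) continuous functions on $\Delta$ (with the product topology) with the supremum norm. "Ideal" always means two-sided ideal, and closed means closed in the operator norm. An operator $T:X\to Y$ between Banach spaces is strictly singular if there is no infinite dimensional Banach space $Z$ and operator $S:Z\to X$ such that $TS$ is an isomorphism onto its image. An ideal in $L(X)$ is called small if it is contained in the ideal of strictly singular operators on $X$. *)

theory Defs
  imports
    "HOL-Analysis.Analysis"
    "HOL-Algebra.Module"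
    "HOL-Algebra.Ideal"
    "HOL-Library.Equipollence"
begin

section \<open>Banach spaces and operators\<close>

text \<open>
  The scalar field is a type \<open>'k\<close>, instantiated to \<^typ>\<open>real\<close> and \<^typ>\<open>complex\<close>.
  Banach spaces are records with an explicit carrier, so that one can quantify over them inside
  a formula. The fields \<open>mult\<close> and \<open>one\<close>, inherited from \<open>ring\<close> by \<open>module\<close>, play no role.
\<close>

definition scalars :: "'k::real_normed_field ring" where
  "scalars = \<lparr>carrier = UNIV, mult = (*), one = 1, zero = 0, add = (+)\<rparr>"

record ('k, 'a) normed_space = "('k, 'a) module" +
  nrm :: "'a \<Rightarrow> real"

definition is_normed_space :: "('k::real_normed_field, 'a) normed_space \<Rightarrow> bool" where
  "is_normed_space X \<longleftrightarrow>
     Module.module scalars X \<and>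
     (\<forall>x\<in>carrier X. 0 \<le> nrm X x \<and> (nrm X x = 0 \<longleftrightarrow> x = \<zero>\<^bsub>X\<^esub>)) \<and>
     (\<forall>x\<in>carrier X. \<forall>y\<in>carrier X. nrm X (x \<oplus>\<^bsub>X\<^esub> y) \<le> nrm X x + nrm X y) \<and>
     (\<forall>c. \<forall>x\<in>carrier X. nrm X (c \<odot>\<^bsub>X\<^esub> x) = norm c * nrm X x)"

definition is_banach_space :: "('k::real_normed_field, 'a) normed_space \<Rightarrow> bool" where
  "is_banach_space X \<longleftrightarrow>
     is_normed_space X \<and>
     (\<forall>s. range s \<subseteq> carrier X \<and>
          (\<forall>e>0. \<exists>N::nat. \<forall>m\<ge>N. \<forall>n\<ge>N. nrm X (s m \<ominus>\<^bsub>X\<^esub> s n) < e) \<longrightarrow>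
          (\<exists>x\<in>carrier X. (\<lambda>n. nrm X (s n \<ominus>\<^bsub>X\<^esub> x)) \<longlonglongrightarrow> 0))"

definition infinite_dimensional :: "('k::real_normed_field, 'a) normed_space \<Rightarrow> bool" where
  "infinite_dimensional X \<longleftrightarrow>
     \<not> (\<exists>B. finite B \<and> B \<subseteq> carrier X \<and>
           (\<forall>x\<in>carrier X. \<exists>a. x = (\<Oplus>\<^bsub>X\<^esub>b\<in>B. a b \<odot>\<^bsub>X\<^esub> b)))"

definition operator ::
  "('k::real_normed_field, 'a) normed_space \<Rightarrow> ('k, 'b) normed_space \<Rightarrow> ('a \<Rightarrow> 'b) \<Rightarrow> bool" where
  "operator X Y T \<longleftrightarrow>
     T \<in> carrier X \<rightarrow> carrier Y \<and>
     (\<forall>x\<in>carrier X. \<forall>y\<in>carrier X. T (x \<oplus>\<^bsub>X\<^esub> y) = T x \<oplus>\<^bsub>Y\<^esub> T y) \<and>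
     (\<forall>c. \<forall>x\<in>carrier X. T (c \<odot>\<^bsub>X\<^esub> x) = c \<odot>\<^bsub>Y\<^esub> T x) \<and>
     (\<exists>K. \<forall>x\<in>carrier X. nrm Y (T x) \<le> K * nrm X x)"

definition isomorphism_onto_image ::
  "('k::real_normed_field, 'a) normed_space \<Rightarrow> ('k, 'b) normed_space \<Rightarrow> ('a \<Rightarrow> 'b) \<Rightarrow> bool" where
  "isomorphism_onto_image X Y T \<longleftrightarrow>
     operator X Y T \<and> inj_on T (carrier X) \<and>
     operator (Y\<lparr>carrier := T ` carrier X\<rparr>) X (inv_into (carrier X) T)"

text \<open>
  HOL cannot quantify over all types, so the carrier of \<open>Z\<close> ranges over the subsets of the type
  \<open>'a\<close> underlying \<open>X\<close>. Nothing is lost: if \<open>T \<circ> S\<close> is injective then so is \<open>S\<close>, and the structure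
  of any \<open>Z\<close> whatsoever can be transported along \<open>S\<close> to the subset \<open>S ` carrier Z\<close> of
  \<open>carrier X\<close>. The operations and the norm of \<open>Z\<close> are arbitrary.
\<close>

definition strictly_singular ::
  "('k::real_normed_field, 'a) normed_space \<Rightarrow> ('k, 'b) normed_space \<Rightarrow> ('a \<Rightarrow> 'b) \<Rightarrow> bool" where
  "strictly_singular X Y T \<longleftrightarrow>
     operator X Y T \<and>
     \<not> (\<exists>(Z :: ('k, 'a) normed_space) S.
           is_banach_space Z \<and> infinite_dimensional Z \<and> operator Z X S \<and>
           isomorphism_onto_image Z Y (T \<circ> S))"


section \<open>The space of continuous functions on the Cantor set\<close>

typedef sign = "{-1, 1 :: int}"
  by blast

instantiation sign :: metric_space
begin

definition dist_sign :: "sign \<Rightarrow> sign \<Rightarrow> real" where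
  "dist_sign x y = real_of_int \<bar>Rep_sign x - Rep_sign y\<bar>"

definition uniformity_sign :: "(sign \<times> sign) filter" where
  "uniformity_sign = (INF e\<in>{0<..}. principal {(x, y). dist x y < e})"

definition open_sign :: "sign set \<Rightarrow> bool" where
  "open_sign U \<longleftrightarrow> (\<forall>x\<in>U. \<forall>\<^sub>F (x', y) in uniformity. x' = x \<longrightarrow> y \<in> U)"

instance
proof
  show "dist x y = 0 \<longleftrightarrow> x = y" for x y :: sign
    by (simp add: dist_sign_def Rep_sign_inject)
  show "dist x y \<le> dist x z + dist y z" for x y z :: sign
    by (simp add: dist_sign_def)
qed (simp_all add: uniformity_sign_def open_sign_def)

end

instance sign :: discrete_topology
proof
  fix U :: "sign set"
  have "y = x" if "dist y x < 1" for x y :: sign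
    using that by (simp add: dist_sign_def flip: Rep_sign_inject)
  then show "open U"
    unfolding open_dist by (metis zero_less_one)
qed

type_synonym cantor = "nat \<Rightarrow> sign"

text \<open>
  The function type carries the product topology. As \<^typ>\<open>cantor\<close> is compact, every continuous
  function on it is bounded, so \<open>cantor \<Rightarrow>\<^sub>C 'k\<close> with its supremum norm is the space of all
  continuous functions.
\<close>

lemma UNIV_sign: "(UNIV :: sign set) = {Abs_sign (-1), Abs_sign 1}"
proof -
  have "x \<in> {Abs_sign (-1), Abs_sign 1}" for x
    using Rep_sign[of x] Rep_sign_inverse[of x] by auto
  then show ?thesis by blast
qed

lemma compact_cantor: "compact (UNIV :: cantor set)"
proof -
  have "finite (UNIV :: sign set)"
    by (simp add: UNIV_sign)
  then have "compact_space (euclidean :: sign topology)"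
    by (simp add: compact_space_def finite_imp_compact)
  then have "compact_space (product_topology (\<lambda>_. euclidean :: sign topology) (UNIV :: nat set))"
    by (simp add: compact_space_product_topology)
  then show ?thesis
    by (simp add: euclidean_product_topology compact_space_def)
qed

lemma continuous_imp_bcontfun:
  fixes f :: "cantor \<Rightarrow> 'k::real_normed_vector"
  assumes "continuous_on UNIV f"
  shows "f \<in> bcontfun"
  using assms compact_continuous_image[OF assms compact_cantor]
  by (simp add: bcontfun_def compact_imp_bounded)

definition pointwise_scale ::
  "'k::real_normed_field \<Rightarrow> (cantor \<Rightarrow>\<^sub>C 'k) \<Rightarrow> (cantor \<Rightarrow>\<^sub>C 'k)" where
  "pointwise_scale c f = Bcontfun (\<lambda>x. c * apply_bcontfun f x)"

lemma apply_pointwise_scale [simp]: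
  "apply_bcontfun (pointwise_scale c f) x = c * apply_bcontfun f x"
  unfolding pointwise_scale_def
  by (subst Bcontfun_inverse) (auto intro!: continuous_imp_bcontfun continuous_intros)

definition C_cantor :: "('k::real_normed_field, cantor \<Rightarrow>\<^sub>C 'k) normed_space" where
  "C_cantor =
     \<lparr>carrier = UNIV, mult = undefined, one = undefined, zero = 0, add = (+),
      smult = pointwise_scale, nrm = norm\<rparr>"


section \<open>Small closed ideals\<close>

text \<open>
  Every bounded \<open>'k\<close>-linear map is bounded and real-linear, so the operators on \<^const>\<open>C_cantor\<close> form
  a subset of the library's type of bounded real-linear maps, whose norm is the operator norm.
  For \<open>'k = complex\<close> the subset is proper.
\<close>

type_synonym 'k cantor_op = "(cantor \<Rightarrow>\<^sub>C 'k) \<Rightarrow>\<^sub>L (cantor \<Rightarrow>\<^sub>C 'k)"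

definition L_C_cantor :: "'k::real_normed_field cantor_op ring" where
  "L_C_cantor =
     \<lparr>carrier = {T. operator C_cantor C_cantor (blinfun_apply T)},
      mult = (o\<^sub>L), one = id_blinfun, zero = 0, add = (+)\<rparr>"

text \<open>
  As \<^const>\<open>L_C_cantor\<close> contains the scalar multiples of the identity, its ring ideals are
  automatically closed under multiplication by scalars.
\<close>

definition small_closed_ideal :: "'k::real_normed_field cantor_op set \<Rightarrow> bool" where
  "small_closed_ideal J \<longleftrightarrow>
     ideal J L_C_cantor \<and>
     closedin (top_of_set (carrier L_C_cantor)) J \<and>
     (\<forall>T\<in>J. strictly_singular C_cantor C_cantor (blinfun_apply T))"

end

theory Submission
  imports Defs "HOL-Probability.Probability" "HOL-Library.Nat_Bijection"
begin

text \<open>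
  A set \<open>E\<close> of finite subsets of the naturals, regarded as a set of characters (Walsh functions) of the
  compact group \<open>\<Delta>\<close>, gives an operator \<open>walsh_op E\<close> on \<open>C(\<Delta>)\<close>: it sends \<open>f\<close> to the family of its Walsh
  coefficients at the members of \<open>E\<close>, a null sequence, placed in a copy of \<open>c\<^sub>0\<close> inside \<open>C(\<Delta>)\<close>.
  Bessel's inequality bounds the norm of the image of \<open>f\<close> by the norm of \<open>f\<close> in \<open>L\<^sub>2\<close>.

  The ideal attached to an operator \<open>U\<close> is \<open>dominated_ideal U\<close>, the set of the operators \<open>T\<close> such that
  for each \<open>e > 0\<close> there are finitely many operators \<open>B\<close> and a constant \<open>C\<close> for which every \<open>f\<close> satisfies
  \<open>\<parallel>T f\<parallel> \<le> C \<parallel>U (B f)\<parallel> + e \<parallel>f\<parallel>\<close> for one of these \<open>B\<close>. Being a closed ideal is immediate from this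
  form. For \<open>U = walsh_op E\<close> it is small: where such a \<open>T\<close> is bounded below, the supremum norm is
  dominated by finitely many \<open>L\<^sub>2\<close> seminorms, and the classical argument with an orthonormal system
  (lemma \<open>finite_dim_if_L2_dominates\<close>) shows that the subspace has finite dimension.

  To obtain many different ideals, take consecutive blocks of coordinates and in the \<open>n\<close>-th block a
  family \<open>E n\<close> of characters that is enormous compared with the number of coordinates but still any
  \<open>2 ^ D n\<close> of its members are independent over the field with two elements, where \<open>D n\<close>
  counts the coordinates of the earlier blocks. So any set of characters taken from blocks after the \<open>n\<close>-th one
  that has at most as many elements as \<open>E n\<close> consists of independent random signs, whereas \<open>E n\<close> itself lives on a group
  of size only \<open>2 ^ D (Suc n)\<close>, which is subexponential in \<open>card (E n)\<close>. For \<open>M\<close> a set of indices put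
  \<open>E\<^sub>M = (\<Union>n\<in>M. E n)\<close>.

  Suppose that \<open>M - M'\<close> is infinite and that \<open>walsh_op E\<^sub>M\<close> is in the ideal of \<open>walsh_op E\<^sub>M\<^sub>'\<close>. Let
  \<open>n\<close> be a large element of \<open>M - M'\<close>. For \<open>k \<noteq> l\<close> in \<open>E n\<close> the function \<open>f = w\<^sub>k - w\<^sub>l\<close> is mapped by
  \<open>walsh_op E\<^sub>M\<close> to a function of norm 1, so for one of the finitely many \<open>B\<close> the function \<open>B f\<close> has a coefficient of size at
  least \<open>\<delta>\<close> at some character \<open>x\<close> in \<open>E\<^sub>M\<^sub>'\<close>, with \<open>\<delta>\<close> independent of \<open>n\<close>. Two facts collide.

  First, the pairs \<open>(x, B)\<close> that occur are many. The vectors of coefficients of the \<open>B w\<^sub>k\<close> are bounded in \<open>\<ell>\<^sub>2\<close>,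
  hence each has boundedly many large entries, and they are separated in the supremum norm by
  the coordinates that occur; so \<open>card (E n)\<close> is at most a fixed power of a fixed multiple of the number of these
  coordinates, up to an additive 1 (lemma \<open>card_separated_le\<close>).

  Secondly, they are few: at most of the order of \<open>D (Suc n)\<close>. The blocks before the \<open>n\<close>-th one contribute at most \<open>2 ^ D n\<close>
  characters. If \<open>x\<close> runs through a set \<open>R\<close> of independent characters from later blocks and the coefficient of \<open>B f\<^sub>x\<close> at \<open>x\<close>
  is large for every \<open>x\<close>, then with suitable signs \<open>a\<^sub>x\<close> the sum of the
  \<open>a\<^sub>x coef x (B f\<^sub>x)\<close> has size of order \<open>card R\<close>. But it is at most \<open>\<parallel>B\<parallel>\<close> times the mean over \<open>s\<close>
  of the supremum over \<open>t\<close> of \<open>\<Sum>x\<in>R. a\<^sub>x w\<^sub>x(s) f\<^sub>x(t)\<close>, and as \<open>t\<close> takes at most \<open>2 ^ D (Suc n)\<close>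
  essentially different values, exponential moments of sums of independent signs make this mean small
  compared with \<open>card R\<close> as soon as \<open>card R\<close> exceeds a multiple of \<open>D (Suc n)\<close> (lemma
  \<open>card_large_coefs_le\<close>).

  As \<open>card (E n)\<close> is at least \<open>D (Suc n) ^ n\<close>, this is a contradiction for large \<open>n\<close>. There are continuum many
  sets \<open>M\<close> with pairwise infinite differences, for example the sets of codes of the initial segments of the sets of naturals.

  The field of scalars enters only through a real inner product, so the real and the
  complex case are treated together, for a normed field that is a Euclidean space.
\<close>


section \<open>Haar measure on the Cantor group\<close>

instance sign :: second_countable_topology
proof
  have "generate_topology UNIV = (open :: sign set \<Rightarrow> bool)"
    by (auto simp: fun_eq_iff Topological_Spaces.open_discrete intro: generate_topology.Basis)
  moreover have "countable (UNIV :: sign set set)"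
    by (rule countable_finite) (simp add: Finite_Set.finite_set UNIV_sign)
  ultimately show "\<exists>B :: sign set set. countable B \<and> open = generate_topology B"
    by metis
qed

text \<open>
  Haar measure of the group \<open>\<Delta>\<close>, realised as the product of the uniform measures on the factors. Its
  invariance enters through the change of a single sign.
\<close>

definition haar :: "cantor measure" where
  "haar = PiM UNIV (\<lambda>_. measure_pmf (pmf_of_set UNIV))"

interpretation coin: product_prob_space "\<lambda>_::nat. measure_pmf (pmf_of_set (UNIV :: sign set))" UNIV
  by unfold_locales

lemma sets_haar [measurable_cong, simp]: "sets haar = sets borel"
proof -
  have "sets haar = sets (PiM UNIV (\<lambda>_::nat. borel :: sign measure))"
    unfolding haar_def
  proof (rule sets_PiM_cong)
    have "A \<in> sets borel" for A :: "sign set"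
      by (rule borel_open) (rule Topological_Spaces.open_discrete)
    then show "sets (measure_pmf (pmf_of_set UNIV)) = sets (borel :: sign measure)"
      by auto
  qed simp
  then show ?thesis
    by (simp add: sets_PiM_equal_borel)
qed

lemma space_haar [simp]: "space haar = UNIV"
  by (simp add: haar_def space_PiM)

interpretation haar: prob_space haar
  unfolding haar_def by (rule coin.prob_space_axioms)

definition flip :: "nat \<Rightarrow> cantor \<Rightarrow> cantor" where
  "flip i s = s(i := Abs_sign (- Rep_sign (s i)))"

lemma Rep_flip: "Rep_sign (flip i s j) = (if j = i then - Rep_sign (s j) else Rep_sign (s j))"
  using Rep_sign[of "s i"] by (auto simp: flip_def Abs_sign_inverse)

lemma continuous_on_sign:
  fixes f :: "sign \<Rightarrow> 'b::topological_space"
  shows "continuous_on A (\<lambda>s::cantor. f (s i))"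
proof (rule continuous_on_compose2[of UNIV f])
  show "continuous_on A (\<lambda>s::cantor. s i)"
    by (rule continuous_on_subset[OF continuous_on_product_coordinates]) simp
qed auto

lemma continuous_on_flip: "continuous_on UNIV (flip i)"
proof (rule continuous_on_coordinatewise_then_product)
  fix j
  show "continuous_on UNIV (\<lambda>s. flip i s j)"
    using continuous_on_sign[of UNIV "\<lambda>x. Abs_sign (- Rep_sign x)" i] continuous_on_sign[of UNIV "\<lambda>x. x" j]
    by (cases "j = i") (simp_all add: flip_def)
qed

lemma measurable_flip: "flip i \<in> measurable haar haar"
  using borel_measurable_continuous_onI[OF continuous_on_flip]
  by (simp add: measurable_cong_sets[OF sets_haar sets_haar])

lemma distr_flip_haar: "distr haar haar (flip i) = haar"
proof -
  let ?M = "\<lambda>_::nat. measure_pmf (pmf_of_set (UNIV :: sign set))"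
  let ?neg = "\<lambda>x. Abs_sign (- Rep_sign x)"
  have neg_neg: "?neg (?neg x) = x" for x
    using Rep_sign[of x] Rep_sign_inverse[of x] by (auto simp: Abs_sign_inverse)
  have bij: "bij ?neg"
    by (rule o_bij[of ?neg]) (auto simp: neg_neg fun_eq_iff)
  have fin: "finite (UNIV :: sign set)"
    by (simp add: UNIV_sign)
  have neg: "emeasure (measure_pmf (pmf_of_set UNIV)) (?neg -` A)
      = emeasure (measure_pmf (pmf_of_set UNIV)) A" for A
  proof -
    have "map_pmf ?neg (pmf_of_set UNIV) = pmf_of_set UNIV"
      using map_pmf_of_set_bij_betw[OF bij _ fin] by simp
    then show ?thesis
      by (metis emeasure_map_pmf)
  qed
  note meas = measurable_flip[of i]
  have "haar = distr haar haar (flip i)"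
    unfolding haar_def
  proof (rule measure_eqI_PiM_infinite)
    fix A and J :: "nat set"
    assume J: "finite J" "J \<subseteq> UNIV" and A: "\<And>j. j \<in> J \<Longrightarrow> A j \<in> sets (?M j)"
    let ?A = "A(i := ?neg -` A i)"
    have emb: "prod_emb UNIV ?M J (Pi\<^sub>E J B) = {s. \<forall>j\<in>J. s j \<in> B j}" for B
      by (auto simp: prod_emb_def PiE_iff space_PiM extensional_def)
    have "flip i -` prod_emb UNIV ?M J (Pi\<^sub>E J A) \<inter> space (PiM UNIV ?M)
        = prod_emb UNIV ?M J (Pi\<^sub>E J ?A)"
      unfolding emb by (auto simp: flip_def space_PiM split: if_splits)
    moreover have "prod_emb UNIV ?M J (Pi\<^sub>E J A) \<in> sets (PiM UNIV ?M)"
      using J A by (intro sets_PiM_I) auto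
    ultimately have "emeasure (distr (PiM UNIV ?M) (PiM UNIV ?M) (flip i)) (prod_emb UNIV ?M J (Pi\<^sub>E J A))
        = emeasure (PiM UNIV ?M) (prod_emb UNIV ?M J (Pi\<^sub>E J ?A))"
      using meas by (subst emeasure_distr) (simp_all only: haar_def)
    also have "\<dots> = (\<Prod>j\<in>J. emeasure (?M j) (?A j))"
      using J by (intro coin.emeasure_PiM_emb) auto
    also have "\<dots> = (\<Prod>j\<in>J. emeasure (?M j) (A j))"
      by (intro prod.cong) (auto simp: neg)
    also have "\<dots> = emeasure (PiM UNIV ?M) (prod_emb UNIV ?M J (Pi\<^sub>E J A))"
      using J by (intro coin.emeasure_PiM_emb[symmetric]) auto
    finally show "emeasure (PiM UNIV ?M) (prod_emb UNIV ?M J (Pi\<^sub>E J A)) =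
      emeasure (distr (PiM UNIV ?M) (PiM UNIV ?M) (flip i)) (prod_emb UNIV ?M J (Pi\<^sub>E J A))" ..
  qed (simp_all add: prob_space.finite_measure[OF coin.prob_space_axioms])
  then show ?thesis ..
qed

lemma integrable_haar [simp]:
  fixes f :: "cantor \<Rightarrow> 'b::{banach, second_countable_topology}"
  assumes "continuous_on UNIV f"
  shows "integrable haar f"
proof -
  have "bounded (range f)"
    using compact_continuous_image[OF assms compact_cantor] compact_imp_bounded by blast
  then obtain b where "\<And>x. norm (f x) \<le> b"
    by (auto simp: bounded_iff)
  then show ?thesis
    using borel_measurable_continuous_onI[OF assms]
    by (intro haar.integrable_const_bound[of _ b]) (auto simp: measurable_cong_sets[OF sets_haar refl])
qed

text \<open>
  Every vanishing integral below comes from this symmetry: a single coordinate whose flip changes the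
  sign of the integrand.
\<close>

lemma integral_haar_eq_0:
  fixes f :: "cantor \<Rightarrow> 'b::{banach, second_countable_topology}"
  assumes "continuous_on UNIV f" and odd: "\<And>s. f (flip i s) = - f s"
  shows "(LINT s|haar. f s) = 0"
proof -
  note meas = measurable_flip[of i]
  have "(LINT s|haar. f s) = (LINT s|distr haar haar (flip i). f s)"
    by (simp add: distr_flip_haar)
  also have "\<dots> = (LINT s|haar. f (flip i s))"
    using meas borel_measurable_continuous_onI[OF assms(1)]
    by (intro integral_distr) (auto simp: measurable_cong_sets[OF sets_haar refl])
  also have "\<dots> = - (LINT s|haar. f s)"
    using assms by simp
  finally have neg: "(LINT s|haar. f s) = - (LINT s|haar. f s)" .
  have "2 *\<^sub>R (LINT s|haar. f s) = (LINT s|haar. f s) + (LINT s|haar. f s)"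
    by (rule scaleR_2)
  also have "\<dots> = 0"
    by (subst (2) neg) (rule right_minus)
  finally show ?thesis
    by (simp only: scaleR_eq_0_iff) simp
qed

section \<open>Walsh functions and Walsh coefficients\<close>

definition walsh :: "nat set \<Rightarrow> cantor \<Rightarrow> real" where
  "walsh x s = (\<Prod>i\<in>x. real_of_int (Rep_sign (s i)))"

lemma walsh_flip:
  "finite x \<Longrightarrow> walsh x (flip i s) = (if i \<in> x then - walsh x s else walsh x s)"
proof (induction x rule: finite_induct)
  case (insert j x)
  then show ?case by (auto simp: walsh_def Rep_flip)
qed (simp add: walsh_def)

lemma abs_walsh [simp]: "\<bar>walsh x s\<bar> = 1"
proof -
  have "\<bar>real_of_int (Rep_sign (s i))\<bar> = 1" for i
    using Rep_sign[of "s i"] by auto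
  then show ?thesis by (simp add: walsh_def abs_prod)
qed

lemma walsh_square [simp]: "walsh x s * walsh x s = 1"
  using abs_walsh[of x s] by (metis abs_mult_self_eq mult_1)

lemma walsh_cong: "(\<And>i. i \<in> x \<Longrightarrow> s i = t i) \<Longrightarrow> walsh x s = walsh x t"
  by (simp add: walsh_def)

lemma continuous_on_walsh [continuous_intros]: "continuous_on A (walsh x)"
  unfolding walsh_def by (intro continuous_on_prod continuous_on_sign)

lemma continuous_on_apply_bcontfun [continuous_intros]:
  "continuous_on A (\<lambda>s. apply_bcontfun f s)"
  by (rule continuous_on_subset[of UNIV]) auto

lemma integral_walsh_mult:
  assumes "finite x" "finite y"
  shows "(LINT s|haar. walsh x s * walsh y s) = of_bool (x = y)"
proof (cases "x = y")
  case True
  then show ?thesis using haar.prob_space by simp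
next
  case False
  then obtain i where "i \<in> x \<longleftrightarrow> i \<notin> y" by blast
  then show ?thesis
    using False assms
    by (subst integral_haar_eq_0[of _ i]) (auto simp: walsh_flip intro!: continuous_intros)
qed

text \<open>
  The square of the distance of \<open>h\<close> to its projection on the span of the characters is nonnegative.
\<close>

lemma bessel_real:
  fixes h :: "cantor \<Rightarrow> real"
  assumes F: "finite F" "\<And>x. x \<in> F \<Longrightarrow> finite x" and h: "continuous_on UNIV h"
  shows "(\<Sum>x\<in>F. (LINT s|haar. walsh x s * h s)\<^sup>2) \<le> (LINT s|haar. (h s)\<^sup>2)"
proof -
  define c where "c x = (LINT s|haar. walsh x s * h s)" for x
  have int: "integrable haar (\<lambda>s. walsh x s * h s)" "integrable haar (\<lambda>s. walsh x s * walsh y s)"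
    "integrable haar (\<lambda>s. (h s)\<^sup>2)" for x y
    using h by (auto intro!: integrable_haar continuous_intros)
  have "0 \<le> (LINT s|haar. (h s - (\<Sum>x\<in>F. c x * walsh x s))\<^sup>2)"
    by (rule Bochner_Integration.integral_nonneg) auto
  also have "\<dots> = (LINT s|haar. (h s)\<^sup>2 - 2 * (\<Sum>x\<in>F. c x * (walsh x s * h s))
      + (\<Sum>x\<in>F. \<Sum>y\<in>F. c x * c y * (walsh x s * walsh y s)))"
  proof (intro Bochner_Integration.integral_cong refl)
    fix s
    let ?S = "\<Sum>x\<in>F. c x * walsh x s"
    have "(h s - ?S)\<^sup>2 = (h s)\<^sup>2 - 2 * (?S * h s) + ?S * ?S"
      by (simp add: power2_eq_square algebra_simps)
    also have "?S * h s = (\<Sum>x\<in>F. c x * (walsh x s * h s))"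
      by (simp add: sum_distrib_right mult.assoc)
    also have "?S * ?S = (\<Sum>x\<in>F. \<Sum>y\<in>F. c x * c y * (walsh x s * walsh y s))"
      by (simp add: sum_product mult_ac)
    finally show "(h s - ?S)\<^sup>2 = (h s)\<^sup>2 - 2 * (\<Sum>x\<in>F. c x * (walsh x s * h s))
      + (\<Sum>x\<in>F. \<Sum>y\<in>F. c x * c y * (walsh x s * walsh y s))" .
  qed
  also have "\<dots> = (LINT s|haar. (h s)\<^sup>2) - 2 * (\<Sum>x\<in>F. c x * c x)
      + (\<Sum>x\<in>F. \<Sum>y\<in>F. c x * c y * of_bool (x = y))"
    using F int by (simp add: integral_walsh_mult c_def del: integrable_haar)
  also have "(\<Sum>x\<in>F. \<Sum>y\<in>F. c x * c y * of_bool (x = y)) = (\<Sum>x\<in>F. c x * c x)"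
    using F by (intro sum.cong) (auto simp: of_bool_def if_distrib cong: if_cong)
  finally show ?thesis
    by (simp add: c_def power2_eq_square)
qed

definition coef :: "nat set \<Rightarrow> (cantor \<Rightarrow>\<^sub>C 'b::euclidean_space) \<Rightarrow> 'b" where
  "coef x g = (LINT s|haar. walsh x s *\<^sub>R apply_bcontfun g s)"

lemma norm_power2_eq_sum_Basis: "(norm z)\<^sup>2 = (\<Sum>b\<in>Basis. (z \<bullet> b)\<^sup>2)" for z :: "'b::euclidean_space"
  unfolding power2_norm_eq_inner by (subst euclidean_inner) (simp add: power2_eq_square)

lemma bessel:
  fixes g :: "cantor \<Rightarrow>\<^sub>C 'b::euclidean_space"
  assumes F: "finite F" "\<And>x. x \<in> F \<Longrightarrow> finite x"
  shows "(\<Sum>x\<in>F. (norm (coef x g))\<^sup>2) \<le> (LINT s|haar. (norm (g s))\<^sup>2)"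
proof -
  have coef: "coef x g \<bullet> b = (LINT s|haar. walsh x s * (g s \<bullet> b))" for x b
    unfolding coef_def
    by (subst integral_inner_left[symmetric]) (auto intro!: integrable_haar continuous_intros)
  have "(\<Sum>x\<in>F. (norm (coef x g))\<^sup>2) = (\<Sum>b\<in>Basis. \<Sum>x\<in>F. (LINT s|haar. walsh x s * (g s \<bullet> b))\<^sup>2)"
    unfolding norm_power2_eq_sum_Basis coef by (rule sum.swap)
  also have "\<dots> \<le> (\<Sum>b\<in>Basis. LINT s|haar. (g s \<bullet> b)\<^sup>2)"
    using F by (intro sum_mono bessel_real continuous_intros)
  also have "\<dots> = (LINT s|haar. (\<Sum>b\<in>Basis. (g s \<bullet> b)\<^sup>2))"
    by (intro Bochner_Integration.integral_sum[symmetric] integrable_haar continuous_intros)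
  finally show ?thesis
    by (simp add: norm_power2_eq_sum_Basis)
qed

lemma norm_coef_le_L2:
  fixes g :: "cantor \<Rightarrow>\<^sub>C 'b::euclidean_space"
  shows "finite x \<Longrightarrow> (norm (coef x g))\<^sup>2 \<le> (LINT s|haar. (norm (g s))\<^sup>2)"
  using bessel[of "{x}" g] by simp

lemma L2_le_norm:
  fixes g :: "cantor \<Rightarrow>\<^sub>C 'b::euclidean_space"
  shows "(LINT s|haar. (norm (g s))\<^sup>2) \<le> (norm g)\<^sup>2"
proof -
  have "(LINT s|haar. (norm (g s))\<^sup>2) \<le> (LINT s|haar. (norm g)\<^sup>2)"
    by (intro integral_mono integrable_haar continuous_intros power_mono norm_bounded) auto
  then show ?thesis using haar.prob_space by simp
qed

lemma norm_coef_le: "finite x \<Longrightarrow> norm (coef x g) \<le> norm g"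
  using norm_coef_le_L2[of x g] L2_le_norm[of g] power2_le_imp_le[of _ "norm g"] by force

lemma coef_add: "coef x (f + g) = coef x f + coef x g"
  unfolding coef_def plus_bcontfun.rep_eq scaleR_add_right
  by (intro Bochner_Integration.integral_add integrable_haar continuous_intros)

lemma coef_scaleR: "coef x (c *\<^sub>R g) = c *\<^sub>R coef x g"
  unfolding coef_def scaleR_bcontfun.rep_eq
  by (subst integral_scaleR_right[symmetric]) (simp_all add: mult_ac)

lemma coef_pointwise_scale:
  fixes g :: "cantor \<Rightarrow>\<^sub>C 'k::{real_normed_field, euclidean_space}"
  shows "coef x (pointwise_scale c g) = c * coef x g"
  unfolding coef_def by (subst integral_mult_right_zero[symmetric]) simp

lemma linear_coef: "linear (coef x)"
  by (intro linearI coef_add coef_scaleR)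

definition walsh_fn :: "nat set \<Rightarrow> cantor \<Rightarrow>\<^sub>C 'k::real_normed_field" where
  "walsh_fn x = Bcontfun (\<lambda>s. of_real (walsh x s))"

lemma apply_walsh_fn [simp]: "apply_bcontfun (walsh_fn x) s = of_real (walsh x s)"
  unfolding walsh_fn_def
  by (subst Bcontfun_inverse) (auto intro!: continuous_imp_bcontfun continuous_intros)

lemma norm_walsh_fn: "norm (walsh_fn x :: cantor \<Rightarrow>\<^sub>C 'k::real_normed_field) \<le> 1"
  by (rule norm_bound) simp

lemma coef_walsh_fn:
  assumes "finite x" "finite y"
  shows "coef x (walsh_fn y :: cantor \<Rightarrow>\<^sub>C 'k::{real_normed_field, euclidean_space}) = of_bool (x = y)"
proof -
  have "coef x (walsh_fn y :: cantor \<Rightarrow>\<^sub>C 'k) = (LINT s|haar. (walsh x s * walsh y s) *\<^sub>R 1)"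
    unfolding coef_def by (simp add: of_real_def)
  also have "\<dots> = (LINT s|haar. walsh x s * walsh y s) *\<^sub>R 1"
    by (intro integral_scaleR_left integrable_haar continuous_intros)
  finally show ?thesis using integral_walsh_mult[OF assms] by (simp add: of_bool_def)
qed

section \<open>Walsh coefficients as an operator into a copy of \<open>c\<^sub>0\<close>\<close>

text \<open>
  The indicator function of the set of the points whose first entry \<open>-1\<close> has index \<open>k\<close>,
  written as a polynomial in the coordinates so that its continuity is evident. These sets are clopen and disjoint;
  they miss only the constant sequence \<open>1\<close>, to which they shrink.
\<close>

definition cell :: "nat \<Rightarrow> cantor \<Rightarrow> real" where
  "cell k s = (\<Prod>i<k. (1 + real_of_int (Rep_sign (s i))) / 2) * ((1 - real_of_int (Rep_sign (s k))) / 2)"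

lemma continuous_on_cell [continuous_intros]: "continuous_on A (cell k)"
  unfolding cell_def
  by (intro continuous_on_mult continuous_on_prod
      continuous_on_sign[where f = "\<lambda>x. (1 + real_of_int (Rep_sign x)) / 2"]
      continuous_on_sign[where f = "\<lambda>x. (1 - real_of_int (Rep_sign x)) / 2"])

lemma cell_cases:
  obtains "\<And>k. cell k s = 0" | k where "\<And>l. cell l s = of_bool (l = k)"
proof (cases "\<exists>k. Rep_sign (s k) = -1")
  case True
  define k where "k = (LEAST k. Rep_sign (s k) = -1)"
  have k: "Rep_sign (s k) = -1"
    using LeastI_ex[OF True] by (simp add: k_def)
  have less: "Rep_sign (s i) = 1" if "i < k" for i
    using not_less_Least[of i] Rep_sign[of "s i"] that by (auto simp: k_def)
  have "cell l s = of_bool (l = k)" for l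
  proof (cases l k rule: linorder_cases)
    case less': less
    then show ?thesis by (simp add: cell_def less)
  next
    case equal
    then show ?thesis by (simp add: cell_def less k)
  next
    case greater
    then show ?thesis using k by (auto simp: cell_def intro!: bexI[of _ k])
  qed
  then show thesis by (rule that(2))
next
  case False
  then have "Rep_sign (s k) = 1" for k
    using Rep_sign[of "s k"] by auto
  then show thesis by (intro that(1)) (simp add: cell_def)
qed

lemma cell_nonempty: "\<exists>s. \<forall>l. cell l s = of_bool (l = k)"
proof
  let ?s = "\<lambda>i. if i = k then Abs_sign (-1) else Abs_sign 1"
  have "cell k ?s = 1"
    by (auto simp: cell_def Abs_sign_inverse)
  then show "\<forall>l. cell l ?s = of_bool (l = k)"
    by (cases ?s rule: cell_cases) auto
qed

text \<open>
  The isometric copy of \<open>c\<^sub>0\<close> in \<open>C(\<Delta>)\<close>; the series has at most one nonzero term at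
  every point.
\<close>

definition spread :: "(nat \<Rightarrow> 'b::real_normed_vector) \<Rightarrow> cantor \<Rightarrow> 'b" where
  "spread a s = (\<Sum>k. cell k s *\<^sub>R a k)"

lemma spread_eq_0: "(\<And>k. cell k s = 0) \<Longrightarrow> spread a s = 0"
  by (simp add: spread_def)

lemma spread_eq: "(\<And>l. cell l s = of_bool (l = k)) \<Longrightarrow> spread a s = a k"
  unfolding spread_def by (subst suminf_finite[of "{k}"]) auto

text \<open>
  The partial sums converge uniformly because the cells are disjoint and the values tend to 0.
\<close>

lemma continuous_on_spread:
  assumes "a \<longlonglongrightarrow> 0"
  shows "continuous_on UNIV (spread a)"
proof (rule uniform_limit_theorem)
  show "uniform_limit UNIV (\<lambda>n s. \<Sum>k<n. cell k s *\<^sub>R a k) (spread a) sequentially"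
  proof (rule uniform_limitI)
    fix e :: real assume "e > 0"
    then obtain N where N: "\<And>n. n \<ge> N \<Longrightarrow> norm (a n) < e"
      using assms by (auto simp: lim_sequentially)
    show "\<forall>\<^sub>F n in sequentially. \<forall>s\<in>UNIV. dist (\<Sum>k<n. cell k s *\<^sub>R a k) (spread a s) < e"
    proof (intro eventually_sequentiallyI ballI)
      fix n s assume "N \<le> n"
      show "dist (\<Sum>k<n. cell k s *\<^sub>R a k) (spread a s) < e"
      proof (cases s rule: cell_cases)
        case 1
        then show ?thesis using \<open>e > 0\<close> by (simp add: spread_eq_0)
      next
        case (2 k)
        have "(\<Sum>l<n. cell l s *\<^sub>R a l) = (if k < n then a k else 0)"
          by (simp add: 2 of_bool_def if_distrib[of "\<lambda>c. c *\<^sub>R _"] cong: if_cong)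
        moreover have "norm (a k) < e" if "\<not> k < n"
          using that N[of k] \<open>N \<le> n\<close> by simp
        ultimately show ?thesis
          using \<open>e > 0\<close> by (simp add: spread_eq[OF 2])
      qed
    qed
  qed
qed (auto intro!: always_eventually continuous_intros)

text \<open>
  Characters are numbered by the binary code of the finite set, the same numbering for all \<open>E\<close>; positions
  outside \<open>E\<close> are filled with 0.
\<close>

definition masked_coefs :: "nat set set \<Rightarrow> (cantor \<Rightarrow>\<^sub>C 'b::euclidean_space) \<Rightarrow> nat \<Rightarrow> 'b" where
  "masked_coefs E g k = (if set_decode k \<in> E then coef (set_decode k) g else 0)"

lemma masked_coefs_tendsto_0: "masked_coefs E g \<longlonglongrightarrow> 0"
proof -
  have "(\<Sum>k<n. (norm (masked_coefs E g k))\<^sup>2) \<le> (norm g)\<^sup>2" for n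
  proof -
    have inj: "inj_on set_decode {..<n}"
      by (rule inj_on_inverseI) (rule set_decode_inverse)
    have "(\<Sum>k<n. (norm (masked_coefs E g k))\<^sup>2) \<le> (\<Sum>k<n. (norm (coef (set_decode k) g))\<^sup>2)"
      by (rule sum_mono) (simp add: masked_coefs_def)
    also have "\<dots> = (\<Sum>x\<in>set_decode ` {..<n}. (norm (coef x g))\<^sup>2)"
      by (simp add: sum.reindex[OF inj])
    also have "\<dots> \<le> (norm g)\<^sup>2"
      by (rule order_trans[OF bessel L2_le_norm]) auto
    finally show ?thesis .
  qed
  then have "summable (\<lambda>k. (norm (masked_coefs E g k))\<^sup>2)"
    by (intro summableI_nonneg_bounded) auto
  then have "(\<lambda>k. (norm (masked_coefs E g k))\<^sup>2) \<longlonglongrightarrow> 0"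
    by (rule summable_LIMSEQ_zero)
  then have "(\<lambda>k. sqrt ((norm (masked_coefs E g k))\<^sup>2)) \<longlonglongrightarrow> sqrt 0"
    by (rule tendsto_real_sqrt)
  then show ?thesis
    by (simp add: tendsto_norm_zero_iff)
qed

definition walsh_op :: "nat set set \<Rightarrow> 'k::{real_normed_field, euclidean_space} cantor_op" where
  "walsh_op E = Blinfun (\<lambda>g. Bcontfun (spread (masked_coefs E g)))"

lemma walsh_op_apply: "walsh_op E g s = spread (masked_coefs E g) s"
proof -
  let ?T = "\<lambda>g :: cantor \<Rightarrow>\<^sub>C 'a. Bcontfun (spread (masked_coefs E g))"
  have T: "?T g s = spread (masked_coefs E g) s" for g s
    by (subst Bcontfun_inverse)
      (auto intro!: continuous_imp_bcontfun continuous_on_spread masked_coefs_tendsto_0)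
  have "bounded_linear ?T"
  proof (rule bounded_linear_intro[of _ 1])
    fix f g :: "cantor \<Rightarrow>\<^sub>C 'a" and c :: real
    show "?T (f + g) = ?T f + ?T g"
    proof (rule bcontfun_eqI)
      fix s show "?T (f + g) s = (?T f + ?T g) s"
        unfolding T plus_bcontfun.rep_eq
        by (cases s rule: cell_cases) (simp_all add: spread_eq_0 spread_eq masked_coefs_def coef_add)
    qed
    show "?T (c *\<^sub>R g) = c *\<^sub>R ?T g"
    proof (rule bcontfun_eqI)
      fix s show "?T (c *\<^sub>R g) s = (c *\<^sub>R ?T g) s"
        unfolding T scaleR_bcontfun.rep_eq
        by (cases s rule: cell_cases) (simp_all add: spread_eq_0 spread_eq masked_coefs_def coef_scaleR)
    qed
    show "norm (?T g) \<le> norm g * 1"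
    proof (rule norm_bound)
      fix s show "norm (?T g s) \<le> norm g * 1"
        unfolding T
        by (cases s rule: cell_cases)
          (simp_all add: spread_eq_0 spread_eq masked_coefs_def norm_coef_le)
    qed
  qed
  then show ?thesis
    by (simp add: walsh_op_def bounded_linear_Blinfun_apply T)
qed

lemma walsh_op_pointwise_scale:
  "walsh_op E (pointwise_scale c g) = pointwise_scale c (walsh_op E g)"
proof (rule bcontfun_eqI)
  fix s show "walsh_op E (pointwise_scale c g) s = pointwise_scale c (walsh_op E g) s"
    unfolding walsh_op_apply apply_pointwise_scale
    by (cases s rule: cell_cases)
      (simp_all add: spread_eq_0 spread_eq masked_coefs_def coef_pointwise_scale)
qed

lemma norm_coef_le_walsh_op:
  assumes "x \<in> E" "finite x"
  shows "norm (coef x g) \<le> norm (walsh_op E g)"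
proof -
  obtain s where s: "\<And>l. cell l s = of_bool (l = set_encode x)"
    using cell_nonempty by metis
  have "walsh_op E g s = coef x g"
    unfolding walsh_op_apply spread_eq[OF s] using assms
    by (simp add: masked_coefs_def set_encode_inverse)
  then show ?thesis
    by (metis norm_bounded)
qed

lemma norm_walsh_op_le:
  assumes "\<And>x. x \<in> E \<Longrightarrow> finite x \<Longrightarrow> norm (coef x g) \<le> r" "0 \<le> r"
  shows "norm (walsh_op E g) \<le> r"
proof (rule norm_bound)
  fix s show "norm (walsh_op E g s) \<le> r"
    unfolding walsh_op_apply
    by (cases s rule: cell_cases) (simp_all add: spread_eq_0 spread_eq masked_coefs_def assms)
qed

section \<open>Large families of words with strong independence\<close>

text \<open>
  A subset of at most \<open>h\<close> elements is the range of a list of \<open>h\<close> choices, each of them an element of \<open>S\<close> or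
  no element at all.
\<close>

lemma card_small_subsets_le:
  assumes "finite S"
  shows "card {T. T \<subseteq> S \<and> card T \<le> h} \<le> (card S + 1) ^ h"
proof (induction h)
  case 0
  have "{T. T \<subseteq> S \<and> card T \<le> 0} = {{}}"
    using assms finite_subset by fastforce
  then show ?case by simp
next
  case (Suc h)
  let ?A = "{T. T \<subseteq> S \<and> card T \<le> h}" and ?o = "insert None (Some ` S)"
  let ?f = "\<lambda>(z, T). case z of None \<Rightarrow> T | Some x \<Rightarrow> insert x T"
  have fin: "finite ?A"
    using assms by simp
  have "{T. T \<subseteq> S \<and> card T \<le> Suc h} \<subseteq> ?f ` (?o \<times> ?A)"
  proof safe
    fix T assume T: "T \<subseteq> S" "card T \<le> Suc h"
    have "finite T" using T assms finite_subset by blast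
    show "T \<in> ?f ` (?o \<times> ?A)"
    proof (cases "T = {}")
      case True
      then show ?thesis by (intro image_eqI[of _ _ "(None, {})"]) auto
    next
      case False
      then obtain x where "x \<in> T" by blast
      then show ?thesis
        using T \<open>finite T\<close>
        by (intro image_eqI[of _ _ "(Some x, T - {x})"]) auto
    qed
  qed
  then have "card {T. T \<subseteq> S \<and> card T \<le> Suc h} \<le> card (?o \<times> ?A)"
    using assms fin by (intro surj_card_le) auto
  also have "\<dots> = (card S + 1) * card ?A"
    using assms by (simp add: card_cartesian_product card_insert_if card_image)
  also have "\<dots> \<le> (card S + 1) * (card S + 1) ^ h"
    by (intro mult_left_mono Suc.IH) simp
  finally show ?case by simp
qed

text \<open>
  Words are finite sets of naturals, seen as vectors over the field with two elements: the sum of the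
  words in \<open>S\<close> is the set of the \<open>i\<close> that lie in an odd number of them, so the condition says that no
  nonempty subfamily of at most \<open>h\<close> words has sum zero.
\<close>

definition independent_upto :: "nat \<Rightarrow> nat set set \<Rightarrow> bool" where
  "independent_upto h E \<longleftrightarrow>
     (\<forall>S\<subseteq>E. S \<noteq> {} \<longrightarrow> finite S \<longrightarrow> card S \<le> h \<longrightarrow> (\<exists>i. odd (card {x \<in> S. i \<in> x})))"

text \<open>
  The greedy bound of Gilbert and Varshamov: in a maximal family, each further word is the sum of fewer than
  \<open>h\<close> members, since otherwise it could be added. So the small subfamilies are at least as numerous as all words.
\<close>

lemma large_independent_family:
  assumes "finite I" "1 \<le> h"
  obtains E where "E \<subseteq> Pow I" "independent_upto h E" "2 ^ card I \<le> (card E + 1) ^ h"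
proof -
  let ?P = "\<lambda>E. E \<subseteq> Pow I \<and> independent_upto h E"
  have "\<exists>E. ?P E \<and> (\<forall>F. ?P F \<longrightarrow> card F \<le> card E)"
  proof (rule ex_has_greatest_nat)
    show "?P {}" by (simp add: independent_upto_def)
    show "\<forall>E. ?P E \<longrightarrow> card E < Suc (card (Pow I))"
      using assms by (simp add: card_mono less_Suc_eq_le)
  qed
  then obtain E where E: "?P E" and max: "\<And>F. ?P F \<Longrightarrow> card F \<le> card E"
    by blast
  have fin: "finite E"
    using E assms by (meson finite_Pow_iff finite_subset)
  let ?A = "{T. T \<subseteq> E \<and> card T \<le> h}" and ?f = "\<lambda>T. {i. odd (card {x \<in> T. i \<in> x})}"
  have "Pow I \<subseteq> ?f ` ?A"
  proof
    fix y assume y: "y \<in> Pow I"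
    show "y \<in> ?f ` ?A"
    proof (cases "y \<in> E")
      case True
      have "?f {y} = y"
      proof (rule Set.set_eqI)
        fix i
        have "{x \<in> {y}. i \<in> x} = (if i \<in> y then {y} else {})" by auto
        then show "i \<in> ?f {y} \<longleftrightarrow> i \<in> y" by simp
      qed
      then show ?thesis
        using True assms by (intro image_eqI[of _ _ "{y}"]) auto
    next
      case False
      have "card (insert y E) > card E"
        using False fin by simp
      then have "\<not> ?P (insert y E)"
        using max[of "insert y E"] by linarith
      then have "\<not> independent_upto h (insert y E)"
        using E y by blast
      then obtain S where S: "S \<subseteq> insert y E" "S \<noteq> {}" "finite S" "card S \<le> h"
        and even: "\<And>i. even (card {x \<in> S. i \<in> x})"
        unfolding independent_upto_def by blast
      have "y \<in> S"
      proof (rule ccontr)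
        assume "y \<notin> S"
        then have "S \<subseteq> E" using S by blast
        then show False
          using E S even unfolding independent_upto_def by blast
      qed
      have "i \<in> ?f (S - {y}) \<longleftrightarrow> i \<in> y" for i
      proof -
        have "{x \<in> S. i \<in> x} = (if i \<in> y then insert y {x \<in> S - {y}. i \<in> x} else {x \<in> S - {y}. i \<in> x})"
          using \<open>y \<in> S\<close> by auto
        then have "card {x \<in> S. i \<in> x} = card {x \<in> S - {y}. i \<in> x} + of_bool (i \<in> y)"
          using S(3) by simp
        then show ?thesis
          using even[of i] by (auto split: if_splits)
      qed
      then have "y = ?f (S - {y})" by blast
      moreover have "S - {y} \<in> ?A"
        using S \<open>y \<in> S\<close> by auto
      ultimately show ?thesis by blast
    qed
  qed
  then have "card (Pow I) \<le> card ?A"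
    using fin by (intro surj_card_le) auto
  also have "\<dots> \<le> (card E + 1) ^ h"
    using fin by (rule card_small_subsets_le)
  finally have "2 ^ card I \<le> (card E + 1) ^ h"
    using assms by (simp add: card_Pow)
  then show thesis using E that by blast
qed

lemma exp_beats_polynomial: "\<exists>D' \<ge> m. 2 ^ D * D' ^ c < (2::nat) ^ D'" 
proof -
  have "(\<lambda>n. (real n * ln 2) ^ c / exp (real n * ln 2)) \<longlonglongrightarrow> 0"
    by (rule filterlim_compose[OF tendsto_power_div_exp_0])
      (intro filterlim_at_top_mult_tendsto_pos[OF tendsto_const] filterlim_real_sequentially, simp)
  then have "(\<lambda>n. (real n * ln 2) ^ c / exp (real n * ln 2) / ln 2 ^ c) \<longlonglongrightarrow> 0"
    by (rule tendsto_divide_zero)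
  then have "(\<lambda>n::nat. (real n ^ c) / 2 ^ n) \<longlonglongrightarrow> 0"
    by (simp add: exp_of_nat_mult power_mult_distrib)
  then have "\<forall>\<^sub>F n in sequentially. real n ^ c / 2 ^ n < 1 / 2 ^ D"
    by (rule order_tendstoD) simp
  then have "\<forall>\<^sub>F n in sequentially. real n ^ c / 2 ^ n < 1 / 2 ^ D \<and> m \<le> n"
    by (intro eventually_conj eventually_ge_at_top)
  then obtain n where n: "real n ^ c / 2 ^ n < 1 / 2 ^ D" "m \<le> n"
    by (auto simp: eventually_sequentially)
  then have "2 ^ D * real n ^ c < 2 ^ n"
    by (simp add: field_simps)
  then have "real (2 ^ D * n ^ c) < real (2 ^ n)"
    by simp
  then have "2 ^ D * n ^ c < (2::nat) ^ n"
    by (simp only: of_nat_less_iff)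
  then show ?thesis using n by blast
qed

text \<open>
  With \<open>D\<close> and \<open>n\<close> fixed, the greedy bound is exponential in the length \<open>D' - D\<close> of the block
  and so exceeds the power \<open>D' ^ n\<close> once \<open>D'\<close> is large.
\<close>

lemma block_exists:
  "\<exists>D' E. n + 2 ^ D \<le> D' \<and> E \<subseteq> Pow {D..<D'} \<and> independent_upto (2 ^ D) E \<and> D' ^ n \<le> card E"
proof -
  obtain D' where D': "n + 2 ^ D \<le> D'" "2 ^ D * D' ^ (n * 2 ^ D) < 2 ^ D'"
    using exp_beats_polynomial by blast
  have "D \<le> D'"
    using D'(1) less_exp[of D] by linarith
  obtain E where E: "E \<subseteq> Pow {D..<D'}" "independent_upto (2 ^ D) E"
    "2 ^ (D' - D) \<le> (card E + 1) ^ 2 ^ D"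
    using large_independent_family[of "{D..<D'}" "2 ^ D"] by auto
  have "D' ^ n \<le> card E"
  proof (rule ccontr)
    assume "\<not> D' ^ n \<le> card E"
    then have "(card E + 1) ^ 2 ^ D \<le> (D' ^ n) ^ 2 ^ D"
      by (intro power_mono) auto
    then have "2 ^ (D' - D) \<le> D' ^ (n * 2 ^ D)"
      using E(3) by (metis order_trans power_mult)
    then have "2 ^ D * 2 ^ (D' - D) \<le> 2 ^ D * D' ^ (n * 2 ^ D)"
      by simp
    then show False
      using D'(2) \<open>D \<le> D'\<close> by (simp flip: power_add)
  qed
  then show ?thesis using D' E by blast
qed

lemma blocks_exist:
  obtains D :: "nat \<Rightarrow> nat" and E :: "nat \<Rightarrow> nat set set" where
    "\<And>n. n + 2 ^ D n \<le> D (Suc n)" "\<And>n. E n \<subseteq> Pow {D n..<D (Suc n)}"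
    "\<And>n. independent_upto (2 ^ D n) (E n)" "\<And>n. D (Suc n) ^ n \<le> card (E n)"
proof -
  define nxt where "nxt n D = (SOME D'. \<exists>E. n + 2 ^ D \<le> D' \<and> E \<subseteq> Pow {D..<D'} \<and>
    independent_upto (2 ^ D) E \<and> D' ^ n \<le> card E)" for n D
  define D where "D = rec_nat 0 nxt"
  have "\<exists>E. n + 2 ^ D n \<le> D (Suc n) \<and> E \<subseteq> Pow {D n..<D (Suc n)} \<and>
    independent_upto (2 ^ D n) E \<and> D (Suc n) ^ n \<le> card E" for n
    unfolding D_def using someI_ex[OF block_exists[of n]] by (simp add: nxt_def)
  then show thesis
    using that[of D] by metis
qed

section \<open>Separated vectors and exponential moments\<close>

text \<open>
  A finite net, with a choice of a nearby point of the net.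
\<close>

lemma finite_quantization:
  fixes r \<eta> :: real
  assumes "0 < \<eta>"
  obtains C :: "'b::euclidean_space set" and q where "finite C"
    "\<And>z. norm z \<le> r \<Longrightarrow> q z \<in> C" "\<And>z. norm z \<le> r \<Longrightarrow> norm (z - q z) < \<eta>"
proof -
  have "\<forall>e>0. \<exists>C. finite C \<and> cball (0::'b) r \<subseteq> (\<Union>c\<in>C. ball c e)"
    using compact_cball[of "0::'b" r] unfolding compact_eq_totally_bounded by (rule conjunct2)
  then obtain C where C: "finite C" "cball (0::'b) r \<subseteq> (\<Union>c\<in>C. ball c \<eta>)"
    using assms by meson
  have "\<exists>c\<in>C. norm (z - c) < \<eta>" if "norm z \<le> r" for z
  proof -
    have "z \<in> (\<Union>c\<in>C. ball c \<eta>)"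
      using C(2) that by (intro subsetD[OF C(2)]) simp
    then show ?thesis
      by (auto simp: dist_norm norm_minus_commute)
  qed
  then obtain q where "\<And>z. norm z \<le> r \<Longrightarrow> q z \<in> C \<and> norm (z - q z) < \<eta>"
    by metis
  then show thesis using C(1) that by blast
qed

text \<open>
  Round every entry of \<open>X k\<close> that is at least \<open>\<eta>\<close> to a net and forget the other entries. The list of
  what remains has at most \<open>s\<close> items and still determines \<open>k\<close>, since vectors with the same list differ
  by less than \<open>2 \<eta>\<close> in every coordinate. It remains to count the lists.
\<close>

lemma card_separated_le:
  fixes X :: "'a \<Rightarrow> 'i \<Rightarrow> 'b::real_normed_vector"
  assumes "finite J" "finite C"
    and sep: "\<And>k l. k \<in> K \<Longrightarrow> l \<in> K \<Longrightarrow> k \<noteq> l \<Longrightarrow> \<exists>i\<in>J. 2 * \<eta> \<le> norm (X k i - X l i)"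
    and sparse: "\<And>k. k \<in> K \<Longrightarrow> card {i \<in> J. \<eta> \<le> norm (X k i)} \<le> s"
    and q: "\<And>k i. k \<in> K \<Longrightarrow> i \<in> J \<Longrightarrow> q (X k i) \<in> C"
      "\<And>k i. k \<in> K \<Longrightarrow> i \<in> J \<Longrightarrow> norm (X k i - q (X k i)) < \<eta>"
  shows "card K \<le> (card J * card C + 1) ^ s"
proof -
  define A where "A k = (\<lambda>i. (i, q (X k i))) ` {i \<in> J. \<eta> \<le> norm (X k i)}" for k
  have "inj_on A K"
  proof (rule inj_onI, rule ccontr)
    fix k l assume kl: "k \<in> K" "l \<in> K" "A k = A l" "k \<noteq> l"
    then obtain i where i: "i \<in> J" "2 * \<eta> \<le> norm (X k i - X l i)"
      using sep by blast
    have A_iff: "\<eta> \<le> norm (X m i) \<and> q (X m i) = c \<longleftrightarrow> (i, c) \<in> A m" for m c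
      using i(1) by (auto simp: A_def)
    show False
    proof (cases "q (X k i) = q (X l i)")
      case True
      have "norm (X k i - X l i) \<le> norm (X k i - q (X k i)) + norm (X l i - q (X l i))"
        using norm_triangle_ineq4[of "X k i - q (X k i)" "X l i - q (X l i)"] True by simp
      then show False
        using q(2)[OF kl(1) i(1)] q(2)[OF kl(2) i(1)] i(2) by linarith
    next
      case False
      then have "norm (X k i) < \<eta>" "norm (X l i) < \<eta>"
        using A_iff[of k] A_iff[of l] kl(3) by (metis not_le)+
      then show False
        using i(2) norm_triangle_ineq4[of "X k i" "X l i"] by linarith
    qed
  qed
  moreover have "A ` K \<subseteq> {T. T \<subseteq> J \<times> C \<and> card T \<le> s}"
  proof safe
    fix k assume k: "k \<in> K"
    show "card (A k) \<le> s"
      unfolding A_def using assms(1) by (intro order_trans[OF card_image_le sparse[OF k]]) simp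
  qed (auto simp: A_def q)
  ultimately have "card K \<le> card {T. T \<subseteq> J \<times> C \<and> card T \<le> s}"
    using assms(1,2) by (intro card_inj_on_le) auto
  also have "\<dots> \<le> (card (J \<times> C) + 1) ^ s"
    using assms(1,2) by (intro card_small_subsets_le) auto
  finally show ?thesis by (simp add: card_cartesian_product)
qed

text \<open>
  The case of a symmetric random sign in Hoeffding's lemma.
\<close>

lemma cosh_le_exp_square: "cosh y \<le> exp (y\<^sup>2 / 2)" for y :: real
proof -
  have *: "cosh y \<le> exp (y\<^sup>2 / 2)" if "0 \<le> y" for y :: real
  proof -
    have "- (2 * y) * (1 / 2) + ln (1 + 1 / 2 * (exp (2 * y) - 1)) \<le> (2 * y)\<^sup>2 / 8"
      using that by (intro Hoeffdings_lemma_aux) auto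
    then have "ln (1 + 1 / 2 * (exp (2 * y) - 1)) \<le> y + y\<^sup>2 / 2"
      by (simp add: power2_eq_square)
    moreover have "1 + 1 / 2 * (exp (2 * y) - 1) = exp y * cosh y"
      using exp_minus_inverse[of y] by (simp add: cosh_def exp_double power2_eq_square distrib_left diff_divide_distrib)
    moreover have "0 < exp y * cosh y" by simp
    ultimately have "exp y * cosh y \<le> exp (y + y\<^sup>2 / 2)"
      by (metis exp_le_cancel_iff exp_ln)
    then show ?thesis by (simp add: exp_add)
  qed
  show ?thesis
    using *[of y] *[of "- y"] by (cases "0 \<le> y") auto
qed

text \<open>
  Some coordinate occurs in an odd number of the factors; flipping it changes the sign of the
  product.
\<close>

lemma integral_prod_walsh:
  assumes "finite S" "S \<noteq> {}" "\<And>x. x \<in> S \<Longrightarrow> finite x" "independent_upto (card S) S"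
  shows "(LINT s|haar. (\<Prod>x\<in>S. walsh x s)) = 0"
proof -
  obtain i where i: "odd (card {x \<in> S. i \<in> x})"
    using assms by (auto simp: independent_upto_def)
  show ?thesis
  proof (rule integral_haar_eq_0[of _ i])
    fix s
    have "(\<Prod>x\<in>S. walsh x (flip i s)) = (\<Prod>x\<in>S. (if i \<in> x then -1 else 1) * walsh x s)"
      using assms by (intro prod.cong) (auto simp: walsh_flip)
    also have "\<dots> = (\<Prod>x\<in>S. if i \<in> x then -1 else 1) * (\<Prod>x\<in>S. walsh x s)"
      by (rule prod.distrib)
    also have "(\<Prod>x\<in>S. if i \<in> x then -1 else 1 :: real) = (-1) ^ card {x \<in> S. i \<in> x}"
      using assms(1) by (simp add: prod.If_cases Int_def)
    finally show "(\<Prod>x\<in>S. walsh x (flip i s)) = - (\<Prod>x\<in>S. walsh x s)"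
      using i by simp
  qed (intro continuous_intros)
qed

lemma independent_upto_subset:
  assumes "independent_upto h E" "F \<subseteq> E" "h' \<le> h"
  shows "independent_upto h' F"
  unfolding independent_upto_def
proof (intro allI impI)
  fix S assume "S \<subseteq> F" "S \<noteq> {}" "finite S" "card S \<le> h'"
  then have "S \<subseteq> E" "card S \<le> h"
    using assms by auto
  then show "\<exists>i. odd (card {x \<in> S. i \<in> x})"
    using assms(1) \<open>S \<noteq> {}\<close> \<open>finite S\<close> unfolding independent_upto_def by blast
qed

text \<open>
  For a value \<open>w = \<plusminus>1\<close> one has \<open>exp (y w) = cosh y + w sinh y\<close>. Multiplying out, all products of at
  least one character integrate to 0: independent characters behave like independent random signs.
\<close>

lemma integral_exp_walsh_sum:
  assumes "finite R" "\<And>x. x \<in> R \<Longrightarrow> finite x" "independent_upto (card R) R"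
  shows "(LINT s|haar. exp (\<Sum>x\<in>R. y x * walsh x s)) = (\<Prod>x\<in>R. cosh (y x))"
proof -
  have exp: "exp (y x * walsh x s) = sinh (y x) * walsh x s + cosh (y x)" for x s
  proof -
    have "walsh x s = 1 \<or> walsh x s = -1"
      using abs_walsh[of x s] by linarith
    then show ?thesis
      using sinh_plus_cosh[of "y x"] cosh_minus_sinh[of "y x"] by auto
  qed
  have "(LINT s|haar. exp (\<Sum>x\<in>R. y x * walsh x s))
      = (LINT s|haar. (\<Sum>S\<in>Pow R. ((\<Prod>x\<in>S. sinh (y x)) * (\<Prod>x\<in>R - S. cosh (y x))) * (\<Prod>x\<in>S. walsh x s)))"
    using assms(1) by (simp add: exp_sum exp prod_add prod.distrib mult_ac)
  also have "\<dots> = (\<Sum>S\<in>Pow R. ((\<Prod>x\<in>S. sinh (y x)) * (\<Prod>x\<in>R - S. cosh (y x))) * (LINT s|haar. (\<Prod>x\<in>S. walsh x s)))"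
    by (subst Bochner_Integration.integral_sum) (auto intro!: integrable_haar continuous_intros)
  also have "\<dots> = (\<Sum>S\<in>{{}}. ((\<Prod>x\<in>S. sinh (y x)) * (\<Prod>x\<in>R - S. cosh (y x))) * (LINT s|haar. (\<Prod>x\<in>S. walsh x s)))"
  proof (rule sum.mono_neutral_right)
    have "(LINT s|haar. (\<Prod>x\<in>S. walsh x s)) = 0" if "S \<subseteq> R" "S \<noteq> {}" for S
    proof (rule integral_prod_walsh)
      show "finite S" using that assms(1) finite_subset by blast
      show "independent_upto (card S) S"
        using assms(1) that by (intro independent_upto_subset[OF assms(3)] card_mono)
    qed (use that assms in auto)
    then show "\<forall>S\<in>Pow R - {{}}. (\<Prod>x\<in>S. sinh (y x)) * (\<Prod>x\<in>R - S. cosh (y x)) *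
        (LINT s|haar. (\<Prod>x\<in>S. walsh x s)) = 0"
      by auto
  qed (use assms(1) in auto)
  finally show ?thesis
    using haar.prob_space by simp
qed

section \<open>Large coefficients along independent characters\<close>

text \<open>
  A function that depends on the first \<open>D\<close> coordinates only takes all its values on \<open>2 ^ D\<close> points.
\<close>

lemma finite_representatives:
  obtains T :: "cantor set" where "finite T" "card T \<le> 2 ^ D" "\<And>t. \<exists>t'\<in>T. \<forall>i<D. t' i = t i"
proof -
  define rep where "rep y i = (if i \<in> y then Abs_sign (-1) else Abs_sign 1)" for y and i :: nat
  show thesis
  proof
    show "finite (rep ` Pow {..<D})" by simp
    show "card (rep ` Pow {..<D}) \<le> 2 ^ D"
      by (rule order_trans[OF card_image_le]) (simp_all add: card_Pow)
    fix t :: cantor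
    have "rep {i. i < D \<and> Rep_sign (t i) = -1} i = t i" if "i < D" for i
      using that Rep_sign[of "t i"] Rep_sign_inverse[of "t i"] by (auto simp: rep_def)
    then show "\<exists>t'\<in>rep ` Pow {..<D}. \<forall>i<D. t' i = t i"
      by (intro bexI[of _ "rep {i. i < D \<and> Rep_sign (t i) = -1}"]) auto
  qed
qed

text \<open>
  A tangent line bound for the exponential. Summed over the representatives \<open>t\<close> it replaces a
  maximum of absolute values by a sum of exponentials, at the cost of the shift \<open>c\<close>, which will be
  the logarithm of the expected value of that sum.
\<close>

lemma abs_le_exp_sum:
  fixes c x :: real
  assumes "0 < \<theta>"
  shows "\<bar>x\<bar> \<le> (c + exp (- c) * (exp (\<theta> * x) + exp (- \<theta> * x))) / \<theta>"
proof -
  have "\<theta> * \<bar>x\<bar> \<le> c + exp (\<theta> * \<bar>x\<bar> - c)"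
    using exp_ge_add_one_self[of "\<theta> * \<bar>x\<bar> - c"] by linarith
  also have "exp (\<theta> * \<bar>x\<bar> - c) = exp (- c) * exp (\<theta> * \<bar>x\<bar>)"
    by (simp flip: exp_add)
  also have "\<dots> \<le> exp (- c) * (exp (\<theta> * x) + exp (- \<theta> * x))"
    by (intro mult_left_mono) (auto simp: abs_if)
  finally show ?thesis
    using assms by (simp add: field_simps)
qed

text \<open>
  At a point \<open>s\<close> the combination of the functions \<open>a x *\<^sub>R walsh x s *\<^sub>R B (g x)\<close> is the value at \<open>s\<close> of \<open>B\<close> applied to the
  combination of the \<open>g x\<close> with the numbers \<open>a x * walsh x s\<close> as coefficients. So it is bounded by \<open>norm B\<close> times the maximum over
  \<open>t\<close> of a sum of the independent signs \<open>walsh x s\<close> with weights at most 2, and the mean of this maximum over \<open>s\<close>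
  is estimated by exponential moments.
\<close>

lemma coef_sum_le:
  fixes \<theta> :: real and B :: "(cantor \<Rightarrow>\<^sub>C 'b::euclidean_space) \<Rightarrow>\<^sub>L (cantor \<Rightarrow>\<^sub>C 'b)"
    and g :: "nat set \<Rightarrow> cantor \<Rightarrow>\<^sub>C 'b"
  assumes R: "finite R" "\<And>x. x \<in> R \<Longrightarrow> finite x" "independent_upto (card R) R"
    and local: "\<And>x s t. x \<in> R \<Longrightarrow> \<forall>i<D. s i = t i \<Longrightarrow> \<gamma> x s = \<gamma> x t"
    and bound: "\<And>x s. x \<in> R \<Longrightarrow> \<bar>\<gamma> x s\<bar> \<le> 2"
    and g: "\<And>x s. x \<in> R \<Longrightarrow> g x s = \<gamma> x s *\<^sub>R u" and u: "norm u \<le> 1"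
    and a: "\<And>x. x \<in> R \<Longrightarrow> \<bar>a x\<bar> \<le> 1"
    and "0 < \<theta>"
  shows "norm (\<Sum>x\<in>R. a x *\<^sub>R coef x (B (g x)))
    \<le> norm B * ((real D + 1) * ln 2 + 2 * \<theta>\<^sup>2 * card R + 1) / \<theta>"
proof -
  obtain T :: "cantor set" where T: "finite T" "card T \<le> 2 ^ D" "\<And>t. \<exists>t'\<in>T. \<forall>i<D. t' i = t i"
    using finite_representatives[of D] by metis
  \<comment> \<open>\<open>exp c\<close> will bound the integral of \<open>H\<close>, a sum of at most \<open>2 * 2 ^ D\<close> exponentials.\<close>
  define c where "c = (real D + 1) * ln 2 + 2 * \<theta>\<^sup>2 * card R"
  define Y where "Y s t = (\<Sum>x\<in>R. a x * \<gamma> x t * walsh x s)" for s t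
  define H where "H s = (\<Sum>t\<in>T. exp (\<theta> * Y s t) + exp (- \<theta> * Y s t))" for s
  have Y_cont: "continuous_on UNIV (\<lambda>s. Y s t)" for t
    unfolding Y_def by (intro continuous_intros)
  have H_cont: "continuous_on UNIV H"
    unfolding H_def by (intro continuous_intros Y_cont)
  have Y_le: "\<bar>Y s t\<bar> \<le> (c + exp (- c) * H s) / \<theta>" for s t
  proof -
    obtain t' where t': "t' \<in> T" "\<forall>i<D. t' i = t i"
      using T(3) by blast
    have "Y s t = Y s t'"
      unfolding Y_def using local t' by (intro sum.cong refl) metis
    then have "\<bar>Y s t\<bar> \<le> (c + exp (- c) * (exp (\<theta> * Y s t') + exp (- \<theta> * Y s t'))) / \<theta>"
      using abs_le_exp_sum[OF \<open>0 < \<theta>\<close>] by metis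
    also have "\<dots> \<le> (c + exp (- c) * H s) / \<theta>"
      unfolding H_def using T(1) t'(1) \<open>0 < \<theta>\<close>
      by (intro divide_right_mono add_left_mono mult_left_mono member_le_sum) auto
    finally show ?thesis .
  qed
  have int_exp: "(LINT s|haar. exp (l * Y s t)) \<le> exp (2 * \<theta>\<^sup>2 * card R)" if l: "\<bar>l\<bar> = \<theta>" for l t
  proof -
    have "(LINT s|haar. exp (l * Y s t)) = (LINT s|haar. exp (\<Sum>x\<in>R. (l * (a x * \<gamma> x t)) * walsh x s))"
      unfolding Y_def by (simp add: sum_distrib_left mult_ac)
    also have "\<dots> = (\<Prod>x\<in>R. cosh (l * (a x * \<gamma> x t)))"
      using R by (rule integral_exp_walsh_sum)
    also have "\<dots> \<le> (\<Prod>x\<in>R. exp (2 * \<theta>\<^sup>2))"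
    proof (intro prod_mono conjI)
      fix x assume x: "x \<in> R"
      have "\<bar>a x * \<gamma> x t\<bar> \<le> 1 * 2"
        unfolding abs_mult using a[OF x] bound[OF x] by (intro mult_mono) auto
      then have "\<bar>l * (a x * \<gamma> x t)\<bar> \<le> \<theta> * 2"
        unfolding abs_mult[of l] l using \<open>0 < \<theta>\<close> by (intro mult_left_mono) auto
      then have "(l * (a x * \<gamma> x t))\<^sup>2 \<le> (\<theta> * 2)\<^sup>2"
        by (rule abs_le_square_iff[THEN iffD1, OF order_trans[OF _ abs_ge_self]])
      then have "(l * (a x * \<gamma> x t))\<^sup>2 / 2 \<le> 2 * \<theta>\<^sup>2"
        by (simp add: power2_eq_square)
      then show "cosh (l * (a x * \<gamma> x t)) \<le> exp (2 * \<theta>\<^sup>2)"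
        by (rule order_trans[OF cosh_le_exp_square exp_le_cancel_iff[THEN iffD2]])
    qed simp
    also have "\<dots> = exp (2 * \<theta>\<^sup>2 * card R)"
      by (simp add: exp_of_nat2_mult)
    finally show ?thesis .
  qed
  have int_term: "(LINT s|haar. exp (\<theta> * Y s t) + exp (- \<theta> * Y s t)) \<le> 2 * exp (2 * \<theta>\<^sup>2 * card R)" for t
  proof -
    have "(LINT s|haar. exp (\<theta> * Y s t) + exp (- \<theta> * Y s t))
        = (LINT s|haar. exp (\<theta> * Y s t)) + (LINT s|haar. exp (- \<theta> * Y s t))"
      by (intro Bochner_Integration.integral_add integrable_haar continuous_intros Y_cont)
    then show ?thesis
      using int_exp[of \<theta> t] int_exp[of "- \<theta>" t] \<open>0 < \<theta>\<close> by simp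
  qed
  have "(LINT s|haar. H s) = (\<Sum>t\<in>T. LINT s|haar. exp (\<theta> * Y s t) + exp (- \<theta> * Y s t))"
    unfolding H_def
    by (intro Bochner_Integration.integral_sum integrable_haar continuous_intros Y_cont)
  also have "\<dots> \<le> (\<Sum>t\<in>T. 2 * exp (2 * \<theta>\<^sup>2 * card R))"
    by (intro sum_mono int_term)
  also have "\<dots> = card T * (2 * exp (2 * \<theta>\<^sup>2 * card R))"
    by simp
  also have "\<dots> \<le> 2 ^ D * (2 * exp (2 * \<theta>\<^sup>2 * card R))"
    using T(2) by (intro mult_right_mono) (simp_all add: numeral_power_le_of_nat_cancel_iff of_nat_le_numeral_power_cancel_iff)
  also have "\<dots> = exp c"
  proof -
    have "exp ((real D + 1) * ln 2) = 2 ^ D * 2"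
      by (simp add: algebra_simps exp_add exp_of_nat_mult)
    then show ?thesis
      by (simp add: c_def exp_add)
  qed
  finally have int_H: "(LINT s|haar. H s) \<le> exp c" .
  let ?G = "\<lambda>s. \<Sum>x\<in>R. (a x * walsh x s) *\<^sub>R g x"
  have norm_G: "norm (?G s) \<le> (c + exp (- c) * H s) / \<theta>" for s
  proof (rule norm_bound)
    fix t
    have "apply_bcontfun (\<Sum>x\<in>A. (a x * walsh x s) *\<^sub>R g x) t = (\<Sum>x\<in>A. (a x * walsh x s) *\<^sub>R g x t)" for A
      by (induction A rule: infinite_finite_induct) (auto simp: plus_bcontfun.rep_eq scaleR_bcontfun.rep_eq)
    then have "apply_bcontfun (?G s) t = Y s t *\<^sub>R u"
      by (simp add: Y_def g scaleR_sum_left mult_ac)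
    then have "norm (apply_bcontfun (?G s) t) \<le> \<bar>Y s t\<bar>"
      using u by (simp add: mult_left_le)
    then show "norm (apply_bcontfun (?G s) t) \<le> (c + exp (- c) * H s) / \<theta>"
      by (rule order_trans[OF _ Y_le])
  qed
  let ?h = "\<lambda>s. \<Sum>x\<in>R. a x *\<^sub>R walsh x s *\<^sub>R B (g x) s"
  have h_cont: "continuous_on UNIV ?h"
    by (intro continuous_intros)
  have h_le: "norm (?h s) \<le> norm B * ((c + exp (- c) * H s) / \<theta>)" for s
  proof -
    have "apply_bcontfun (\<Sum>x\<in>A. (a x * walsh x s) *\<^sub>R B (g x)) s = (\<Sum>x\<in>A. (a x * walsh x s) *\<^sub>R B (g x) s)" for A
      by (induction A rule: infinite_finite_induct) (auto simp: plus_bcontfun.rep_eq scaleR_bcontfun.rep_eq)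
    then have "?h s = apply_bcontfun (B (?G s)) s"
      by (simp add: blinfun.sum_right blinfun.scaleR_right)
    then have "norm (?h s) \<le> norm (B (?G s))"
      using norm_bounded[of "B (?G s)" s] by (simp only:)
    also have "\<dots> \<le> norm B * norm (?G s)"
      by (rule norm_blinfun)
    also have "\<dots> \<le> norm B * ((c + exp (- c) * H s) / \<theta>)"
      by (intro mult_left_mono norm_G) simp
    finally show ?thesis .
  qed
  have "(\<Sum>x\<in>R. a x *\<^sub>R coef x (B (g x))) = (LINT s|haar. ?h s)"
    unfolding coef_def integral_scaleR_right[symmetric]
    by (subst Bochner_Integration.integral_sum) (intro integrable_haar continuous_intros refl)+
  then have "norm (\<Sum>x\<in>R. a x *\<^sub>R coef x (B (g x))) \<le> (LINT s|haar. norm (?h s))"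
    using integral_norm_bound[of haar ?h] by (simp only:)
  also have "\<dots> \<le> (LINT s|haar. norm B * ((c + exp (- c) * H s) / \<theta>))"
    using \<open>0 < \<theta>\<close> by (intro integral_mono integrable_haar h_le continuous_intros h_cont H_cont) auto
  also have "\<dots> = norm B * ((c + exp (- c) * (LINT s|haar. H s)) / \<theta>)"
    using H_cont haar.prob_space by simp
  also have "\<dots> \<le> norm B * ((c + exp (- c) * exp c) / \<theta>)"
    using \<open>0 < \<theta>\<close> int_H by (intro mult_left_mono divide_right_mono add_left_mono) auto
  also have "\<dots> = norm B * ((real D + 1) * ln 2 + 2 * \<theta>\<^sup>2 * card R + 1) / \<theta>"
    by (simp add: c_def flip: exp_add)
  finally show ?thesis .
qed

text \<open>
  In every coordinate of the Euclidean space, signs that make all terms nonnegative turn the previous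
  bound into one for the sum of the absolute values. The choice of \<open>\<theta>\<close> lets the part of that bound that is linear
  in \<open>card R\<close> be absorbed by the left-hand side.
\<close>

lemma card_large_coefs_le:
  fixes B :: "(cantor \<Rightarrow>\<^sub>C 'b::euclidean_space) \<Rightarrow>\<^sub>L (cantor \<Rightarrow>\<^sub>C 'b)"
    and g :: "nat set \<Rightarrow> cantor \<Rightarrow>\<^sub>C 'b"
  assumes R: "finite R" "\<And>x. x \<in> R \<Longrightarrow> finite x" "independent_upto (card R) R"
    and local: "\<And>x s t. x \<in> R \<Longrightarrow> \<forall>i<D. s i = t i \<Longrightarrow> \<gamma> x s = \<gamma> x t"
    and bound: "\<And>x s. x \<in> R \<Longrightarrow> \<bar>\<gamma> x s\<bar> \<le> 2"
    and g: "\<And>x s. x \<in> R \<Longrightarrow> g x s = \<gamma> x s *\<^sub>R u" and u: "norm u \<le> 1"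
    and large: "\<And>x. x \<in> R \<Longrightarrow> \<delta> \<le> norm (coef x (B (g x)))" and "0 < \<delta>"
    and \<beta>: "norm B \<le> \<beta>" "0 < \<beta>"
  shows "real (card R) \<le> 8 * (real DIM('b) * \<beta> / \<delta>)\<^sup>2 * (real D + 2)"
proof -
  define m where "m = real DIM('b)"
  \<comment> \<open>This value makes \<open>m * \<beta> * 2 * \<theta> = \<delta> / 2\<close>.\<close>
  define \<theta> where "\<theta> = \<delta> / (4 * m * \<beta>)"
  have "0 < m" by (simp add: m_def)
  then have "0 < \<theta>" using \<open>0 < \<delta>\<close> \<open>0 < \<beta>\<close> by (simp add: \<theta>_def)
  define X where "X = \<beta> * (real D + 2 + 2 * \<theta>\<^sup>2 * card R) / \<theta>"
  have X: "norm (\<Sum>x\<in>R. a x *\<^sub>R coef x (B (g x))) \<le> X" if "\<And>x. x \<in> R \<Longrightarrow> \<bar>a x\<bar> \<le> 1" for a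
  proof -
    have "(real D + 1) * ln 2 \<le> (real D + 1) * 1"
      using ln_le_minus_one[of 2] by (intro mult_left_mono) auto
    then have le: "norm B * ((real D + 1) * ln 2 + 2 * \<theta>\<^sup>2 * card R + 1) / \<theta> \<le> X"
      unfolding X_def using \<beta> \<open>0 < \<theta>\<close>
      by (intro divide_right_mono mult_mono) (auto simp: algebra_simps)
    show ?thesis
    proof (rule order_trans[OF _ le], rule coef_sum_le[where \<gamma> = \<gamma> and u = u])
      show "\<gamma> x s = \<gamma> x t" if "x \<in> R" "\<forall>i<D. s i = t i" for x s t
        using that by (rule local)
    qed (fact R bound g u that \<open>0 < \<theta>\<close>)+
  qed
  have "(\<Sum>x\<in>R. \<bar>coef x (B (g x)) \<bullet> b\<bar>) \<le> X" if "b \<in> Basis" for b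
  proof -
    have "(\<Sum>x\<in>R. \<bar>coef x (B (g x)) \<bullet> b\<bar>) = (\<Sum>x\<in>R. sgn (coef x (B (g x)) \<bullet> b) *\<^sub>R coef x (B (g x))) \<bullet> b"
      by (simp add: inner_sum_left abs_sgn mult.commute)
    also have "\<dots> \<le> norm (\<Sum>x\<in>R. sgn (coef x (B (g x)) \<bullet> b) *\<^sub>R coef x (B (g x)))"
      by (rule order_trans[OF abs_ge_self Basis_le_norm[OF that]])
    also have "\<dots> \<le> X"
      by (rule X) (simp add: sgn_real_def)
    finally show ?thesis .
  qed
  then have "(\<Sum>b\<in>Basis. \<Sum>x\<in>R. \<bar>coef x (B (g x)) \<bullet> b\<bar>) \<le> (\<Sum>b\<in>(Basis :: 'b set). X)"
    by (rule sum_mono)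
  also have "\<dots> = m * X" by (simp add: m_def)
  finally have "(\<Sum>x\<in>R. \<Sum>b\<in>Basis. \<bar>coef x (B (g x)) \<bullet> b\<bar>) \<le> m * X"
    by (subst sum.swap)
  moreover have "(\<Sum>x\<in>R. \<delta>) \<le> (\<Sum>x\<in>R. \<Sum>b\<in>Basis. \<bar>coef x (B (g x)) \<bullet> b\<bar>)"
    by (intro sum_mono order_trans[OF large norm_le_l1])
  ultimately have "card R * \<delta> \<le> m * X" by simp
  also have "m * X = 4 * (m * \<beta>)\<^sup>2 / \<delta> * (real D + 2) + card R * \<delta> / 2"
    unfolding X_def \<theta>_def using \<open>0 < m\<close> \<open>0 < \<delta>\<close> \<open>0 < \<beta>\<close>
    by (simp add: field_simps power2_eq_square)
  finally show ?thesis
    using \<open>0 < \<delta>\<close> by (simp add: m_def field_simps power2_eq_square)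
qed

section \<open>Closed ideals given by domination\<close>

lemma in_carrier_L_iff:
  "T \<in> carrier L_C_cantor \<longleftrightarrow> (\<forall>c f. T (pointwise_scale c f) = pointwise_scale c (T f))"
proof -
  have "\<exists>K. \<forall>x. norm (T x) \<le> K * norm x"
    using norm_blinfun by blast
  then show ?thesis
    by (simp add: L_C_cantor_def operator_def C_cantor_def blinfun.add_right)
qed

lemma pointwise_scale_add: "pointwise_scale c (f + g) = pointwise_scale c f + pointwise_scale c g"
  by (rule bcontfun_eqI) (simp add: plus_bcontfun.rep_eq distrib_left)

lemma pointwise_scale_of_real: "pointwise_scale (of_real r) f = r *\<^sub>R f"
  by (rule bcontfun_eqI) (simp add: scaleR_conv_of_real)

lemma pointwise_scale_minus: "pointwise_scale c (- f) = - pointwise_scale c f"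
  by (rule bcontfun_eqI) (simp add: uminus_bcontfun.rep_eq)

lemma L_C_cantor_simps [simp]:
  "add L_C_cantor = (+)" "mult L_C_cantor = (o\<^sub>L)" "zero L_C_cantor = 0" "one L_C_cantor = id_blinfun"
  by (simp_all add: L_C_cantor_def)

lemma carrier_L_closed:
  assumes "S \<in> carrier L_C_cantor" "T \<in> carrier L_C_cantor"
  shows "S + T \<in> carrier L_C_cantor" "S o\<^sub>L T \<in> carrier L_C_cantor" "- S \<in> carrier L_C_cantor"
  using assms
  by (simp_all add: in_carrier_L_iff blinfun.add_left blinfun.minus_left pointwise_scale_add pointwise_scale_minus)

lemma carrier_L_consts:
  "(0 :: 'k::real_normed_field cantor_op) \<in> carrier L_C_cantor"
  "(id_blinfun :: 'k cantor_op) \<in> carrier L_C_cantor"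
proof -
  have "pointwise_scale c 0 = (0 :: cantor \<Rightarrow>\<^sub>C 'k)" for c
    by (rule bcontfun_eqI) simp
  then show "(0 :: 'k cantor_op) \<in> carrier L_C_cantor"
    by (simp add: in_carrier_L_iff)
qed (simp add: in_carrier_L_iff)

lemma ring_L_C_cantor: "Ring.ring (L_C_cantor :: 'k::real_normed_field cantor_op ring)"
proof (rule Ring.ringI)
  show "abelian_group (L_C_cantor :: 'k cantor_op ring)"
  proof (rule abelian_groupI)
    fix T :: "'k cantor_op" assume "T \<in> carrier L_C_cantor"
    then show "\<exists>S\<in>carrier L_C_cantor. S \<oplus>\<^bsub>L_C_cantor\<^esub> T = \<zero>\<^bsub>L_C_cantor\<^esub>"
      by (intro bexI[of _ "- T"]) (simp_all add: carrier_L_closed)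
  qed (simp_all add: carrier_L_closed carrier_L_consts add_ac)
  show "Group.monoid (L_C_cantor :: 'k cantor_op ring)"
    by (rule Group.monoidI) (auto simp: carrier_L_closed carrier_L_consts intro!: blinfun_eqI)
qed (auto simp: blinfun.add_left blinfun.add_right intro!: blinfun_eqI)

text \<open>
  A closed ideal that contains \<open>U\<close>. It may be larger than the closed ideal generated by \<open>U\<close>, since
  nothing is required of the way in which \<open>T f\<close> is obtained from the vectors \<open>U (B f)\<close>; this makes
  the closure properties evident and still lets the ideals be told apart. The clause
  \<open>\<exists>B\<in>\<B>\<close> stands for the maximum over \<open>\<B>\<close>.
\<close>

definition dominated_ideal :: "'k::real_normed_field cantor_op \<Rightarrow> 'k cantor_op set" where
  "dominated_ideal U = {T \<in> carrier L_C_cantor. \<forall>e>0. \<exists>\<B> C. finite \<B> \<and> \<B> \<subseteq> carrier L_C_cantor \<and> 0 \<le> C \<and>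
     (\<forall>f. \<exists>B\<in>\<B>. norm (T f) \<le> C * norm (U (B f)) + e * norm f)}"

lemma dominated_idealD:
  fixes T U :: "'k::real_normed_field cantor_op"
  assumes "T \<in> dominated_ideal U" "0 < e"
  obtains \<B> C where "finite \<B>" "\<B> \<subseteq> carrier L_C_cantor" "0 \<le> C"
    "\<And>f. \<exists>B\<in>\<B>. norm (T f) \<le> C * norm (U (B f)) + e * norm f"
  using assms unfolding dominated_ideal_def by blast

lemma dominated_idealI:
  fixes T U :: "'k::real_normed_field cantor_op"
  assumes "T \<in> carrier L_C_cantor"
    and "\<And>e. 0 < e \<Longrightarrow> \<exists>\<B> C. finite \<B> \<and> \<B> \<subseteq> carrier L_C_cantor \<and> 0 \<le> C \<and>
      (\<forall>f. \<exists>B\<in>\<B>. norm (T f) \<le> C * norm (U (B f)) + e * norm f)"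
  shows "T \<in> dominated_ideal U"
  using assms unfolding dominated_ideal_def by blast

lemma generator_in_dominated_ideal:
  fixes U :: "'k::real_normed_field cantor_op"
  assumes "U \<in> carrier L_C_cantor"
  shows "U \<in> dominated_ideal U"
proof (rule dominated_idealI[OF assms])
  fix e :: real assume "0 < e"
  show "\<exists>\<B> C. finite \<B> \<and> \<B> \<subseteq> carrier L_C_cantor \<and> 0 \<le> C \<and>
      (\<forall>f. \<exists>B\<in>\<B>. norm (U f) \<le> C * norm (U (B f)) + e * norm f)"
    using carrier_L_consts(2) \<open>0 < e\<close>
    by (intro exI[of _ "{id_blinfun}"] exI[of _ 1]) auto
qed

lemma dominated_ideal_add:
  fixes S T U :: "'k::real_normed_field cantor_op"
  assumes "S \<in> dominated_ideal U" "T \<in> dominated_ideal U"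
  shows "S + T \<in> dominated_ideal U"
proof (rule dominated_idealI)
  show "S + T \<in> carrier L_C_cantor"
    using assms by (simp add: dominated_ideal_def carrier_L_closed)
  fix e :: real assume "0 < e"
  then have "0 < e / 2" by simp
  obtain \<A> C where S: "finite \<A>" "\<A> \<subseteq> carrier L_C_cantor" "0 \<le> C"
    "\<And>f. \<exists>B\<in>\<A>. norm (S f) \<le> C * norm (U (B f)) + e / 2 * norm f"
    using dominated_idealD[OF assms(1) \<open>0 < e / 2\<close>] by metis
  obtain \<B> D where T: "finite \<B>" "\<B> \<subseteq> carrier L_C_cantor" "0 \<le> D"
    "\<And>f. \<exists>B\<in>\<B>. norm (T f) \<le> D * norm (U (B f)) + e / 2 * norm f"
    using dominated_idealD[OF assms(2) \<open>0 < e / 2\<close>] by metis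
  have "\<exists>B\<in>\<A> \<union> \<B>. norm ((S + T) f) \<le> (C + D) * norm (U (B f)) + e * norm f" for f
  proof -
    obtain A B where A: "A \<in> \<A>" "norm (S f) \<le> C * norm (U (A f)) + e / 2 * norm f"
      and B: "B \<in> \<B>" "norm (T f) \<le> D * norm (U (B f)) + e / 2 * norm f"
      using S(4) T(4) by blast
    define m where "m = max (norm (U (A f))) (norm (U (B f)))"
    have "norm ((S + T) f) \<le> norm (S f) + norm (T f)"
      by (simp add: blinfun.add_left norm_triangle_ineq)
    also have "\<dots> \<le> C * norm (U (A f)) + D * norm (U (B f)) + e * norm f"
      using A(2) B(2) by linarith
    also have "\<dots> \<le> C * m + D * m + e * norm f"
      using S(3) T(3) \<open>0 < e\<close> by (intro add_mono mult_left_mono) (auto simp: m_def)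
    finally show ?thesis
      using A(1) B(1) unfolding m_def max_def by (auto simp: distrib_right split: if_splits)
  qed
  then show "\<exists>\<B> C. finite \<B> \<and> \<B> \<subseteq> carrier L_C_cantor \<and> 0 \<le> C \<and>
      (\<forall>f. \<exists>B\<in>\<B>. norm ((S + T) f) \<le> C * norm (U (B f)) + e * norm f)"
    using S(1-3) T(1-3) by (intro exI[of _ "\<A> \<union> \<B>"] exI[of _ "C + D"]) auto
qed

lemma dominated_ideal_comp:
  fixes A T U :: "'k::real_normed_field cantor_op"
  assumes T: "T \<in> dominated_ideal U" and A: "A \<in> carrier L_C_cantor"
  shows "A o\<^sub>L T \<in> dominated_ideal U" "T o\<^sub>L A \<in> dominated_ideal U"
proof -
  have carrier: "T \<in> carrier L_C_cantor"
    using T by (simp add: dominated_ideal_def)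
  let ?a = "norm A + 1"
  have a: "0 < ?a" by (intro add_nonneg_pos) auto
  show "A o\<^sub>L T \<in> dominated_ideal U"
  proof (rule dominated_idealI[OF carrier_L_closed(2)[OF A carrier]])
    fix e :: real assume "0 < e"
    then have "0 < e / ?a"
      using a by (rule divide_pos_pos)
    then obtain \<B> C where *: "finite \<B>" "\<B> \<subseteq> carrier L_C_cantor" "0 \<le> C"
      "\<And>f. \<exists>B\<in>\<B>. norm (T f) \<le> C * norm (U (B f)) + e / ?a * norm f"
      using dominated_idealD[OF T] by metis
    have "\<exists>B\<in>\<B>. norm ((A o\<^sub>L T) f) \<le> (?a * C) * norm (U (B f)) + e * norm f" for f
    proof -
      obtain B where B: "B \<in> \<B>" "norm (T f) \<le> C * norm (U (B f)) + e / ?a * norm f"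
        using *(4) by blast
      have "norm ((A o\<^sub>L T) f) \<le> norm A * norm (T f)"
        by (simp add: norm_blinfun)
      also have "\<dots> \<le> ?a * (C * norm (U (B f)) + e / ?a * norm f)"
        using B(2) by (intro mult_mono) auto
      also have "\<dots> = (?a * C) * norm (U (B f)) + ?a * (e / ?a) * norm f"
        by (simp only: distrib_left mult.assoc)
      also have "?a * (e / ?a) = e"
        using a by simp
      finally show ?thesis using B(1) by blast
    qed
    then show "\<exists>\<B> C. finite \<B> \<and> \<B> \<subseteq> carrier L_C_cantor \<and> 0 \<le> C \<and>
      (\<forall>f. \<exists>B\<in>\<B>. norm ((A o\<^sub>L T) f) \<le> C * norm (U (B f)) + e * norm f)"
      using *(1-3) by (intro exI[of _ \<B>] exI[of _ "?a * C"]) auto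
  qed
  show "T o\<^sub>L A \<in> dominated_ideal U"
  proof (rule dominated_idealI[OF carrier_L_closed(2)[OF carrier A]])
    fix e :: real assume "0 < e"
    then have pos: "0 < e / ?a"
      using a by (rule divide_pos_pos)
    then obtain \<B> C where *: "finite \<B>" "\<B> \<subseteq> carrier L_C_cantor" "0 \<le> C"
      "\<And>f. \<exists>B\<in>\<B>. norm (T f) \<le> C * norm (U (B f)) + e / ?a * norm f"
      using dominated_idealD[OF T] by metis
    have "\<exists>B\<in>(\<lambda>B. B o\<^sub>L A) ` \<B>. norm ((T o\<^sub>L A) f) \<le> C * norm (U (B f)) + e * norm f" for f
    proof -
      obtain B where B: "B \<in> \<B>" "norm (T (A f)) \<le> C * norm (U (B (A f))) + e / ?a * norm (A f)"
        using *(4) by blast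
      have "norm (A f) \<le> ?a * norm f"
        using norm_blinfun[of A f] mult_right_mono[of "norm A" ?a "norm f"] by simp
      then have "e / ?a * norm (A f) \<le> e / ?a * (?a * norm f)"
        using pos by (intro mult_left_mono) auto
      also have "\<dots> = e * norm f"
        using a by simp
      finally show ?thesis using B by (intro bexI[of _ "B o\<^sub>L A"]) auto
    qed
    moreover have "(\<lambda>B. B o\<^sub>L A) ` \<B> \<subseteq> carrier L_C_cantor"
      using *(2) A carrier_L_closed(2) by blast
    ultimately show "\<exists>\<B> C. finite \<B> \<and> \<B> \<subseteq> carrier L_C_cantor \<and> 0 \<le> C \<and>
      (\<forall>f. \<exists>B\<in>\<B>. norm ((T o\<^sub>L A) f) \<le> C * norm (U (B f)) + e * norm f)"
      using *(1,3) by (intro exI[of _ "(\<lambda>B. B o\<^sub>L A) ` \<B>"] exI[of _ C]) auto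
  qed
qed

lemma ideal_dominated_ideal:
  fixes U :: "'k::real_normed_field cantor_op"
  assumes "U \<in> carrier L_C_cantor"
  shows "ideal (dominated_ideal U) L_C_cantor"
proof (rule idealI[OF ring_L_C_cantor])
  interpret R: Ring.ring "L_C_cantor :: 'k cantor_op ring" by (rule ring_L_C_cantor)
  show "subgroup (dominated_ideal U) (add_monoid L_C_cantor)"
  proof (rule R.add.subgroupI)
    fix T :: "'k cantor_op" assume T: "T \<in> dominated_ideal U"
    then have carrier: "T \<in> carrier L_C_cantor"
      by (simp add: dominated_ideal_def)
    \<comment> \<open>The opposite of \<open>T\<close> is a multiple of \<open>T\<close> inside the ring.\<close>
    have "\<ominus>\<^bsub>L_C_cantor\<^esub> T = - T"
      using carrier by (intro R.minus_equality) (simp_all add: carrier_L_closed)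
    moreover have "- T = (- id_blinfun) o\<^sub>L T"
      by (rule blinfun_eqI) (simp add: blinfun.minus_left)
    moreover have "(- id_blinfun) o\<^sub>L T \<in> dominated_ideal U"
      by (intro dominated_ideal_comp(1)[OF T] carrier_L_closed(3)[OF carrier_L_consts(2) carrier_L_consts(2)])
    ultimately show "\<ominus>\<^bsub>L_C_cantor\<^esub> T \<in> dominated_ideal U"
      by simp
  next
    show "dominated_ideal U \<subseteq> carrier L_C_cantor"
      unfolding dominated_ideal_def by blast
    show "dominated_ideal U \<noteq> {}"
      using generator_in_dominated_ideal[OF assms] by blast
    show "S \<oplus>\<^bsub>L_C_cantor\<^esub> T \<in> dominated_ideal U"
      if "S \<in> dominated_ideal U" "T \<in> dominated_ideal U" for S T
      using dominated_ideal_add[OF that] by simp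
  qed
qed (simp_all add: dominated_ideal_comp)

lemma closedin_dominated_ideal:
  fixes U :: "'k::real_normed_field cantor_op"
  shows   "closedin (top_of_set (carrier L_C_cantor)) (dominated_ideal U)"
proof -
  have "dominated_ideal U = carrier L_C_cantor \<inter> closure (dominated_ideal U)"
  proof safe
    fix T :: "'k cantor_op" assume T: "T \<in> carrier L_C_cantor" "T \<in> closure (dominated_ideal U)"
    show "T \<in> dominated_ideal U"
    proof (rule dominated_idealI[OF T(1)])
      fix e :: real assume "0 < e"
      then have "0 < e / 2" by simp
      then obtain S where S: "S \<in> dominated_ideal U" "dist S T < e / 2"
        using T(2) unfolding closure_approachable by blast
      obtain \<B> C where *: "finite \<B>" "\<B> \<subseteq> carrier L_C_cantor" "0 \<le> C"
        "\<And>f. \<exists>B\<in>\<B>. norm (S f) \<le> C * norm (U (B f)) + e / 2 * norm f"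
        using dominated_idealD[OF S(1) \<open>0 < e / 2\<close>] by metis
      have "\<exists>B\<in>\<B>. norm (T f) \<le> C * norm (U (B f)) + e * norm f" for f
      proof -
        obtain B where B: "B \<in> \<B>" "norm (S f) \<le> C * norm (U (B f)) + e / 2 * norm f"
          using *(4) by blast
        have "norm (T f) \<le> norm (S f) + norm ((T - S) f)"
          using norm_triangle_ineq[of "S f" "(T - S) f"] by (simp add: blinfun.diff_left)
        moreover have "norm ((T - S) f) \<le> norm (T - S) * norm f"
          by (rule norm_blinfun)
        moreover have "norm (T - S) * norm f \<le> e / 2 * norm f"
          using S(2) by (intro mult_right_mono) (auto simp: dist_norm norm_minus_commute)
        ultimately show ?thesis using B by (intro bexI[of _ B]) auto
      qed
      then show "\<exists>\<B> C. finite \<B> \<and> \<B> \<subseteq> carrier L_C_cantor \<and> 0 \<le> C \<and>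
        (\<forall>f. \<exists>B\<in>\<B>. norm (T f) \<le> C * norm (U (B f)) + e * norm f)"
        using *(1-3) by blast
    qed
  qed (auto simp: dominated_ideal_def closure_subset[THEN subsetD])
  then show ?thesis
    unfolding closedin_closed by (metis closed_closure)
qed

section \<open>Strict singularity\<close>

text \<open>
  The classical proof that a space of bounded functions on which the supremum norm is dominated by the
  norm of \<open>L\<^sub>2\<close> has finite dimension, with the finitely many seminorms \<open>f \<mapsto> \<parallel>B f\<parallel>\<^sub>2\<close> in
  place of one. Let \<open>F\<close> be orthonormal for the sum \<open>ip\<close> of the corresponding inner products. Testing the
  domination on the combination of the \<open>f \<in> F\<close> whose coefficients are the values \<open>B f s\<close> (one
  coordinate of them) bounds the sum of the squares of these values, at every point \<open>s\<close>; integration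
  bounds \<open>card F\<close>. An orthonormal family of maximal size spans.
\<close>

lemma finite_dim_if_L2_dominates:
  fixes V :: "(cantor \<Rightarrow>\<^sub>C 'b::euclidean_space) set"
    and \<B> :: "((cantor \<Rightarrow>\<^sub>C 'b) \<Rightarrow>\<^sub>L (cantor \<Rightarrow>\<^sub>C 'b)) set"
  assumes V: "subspace V" and "finite \<B>" and "0 \<le> c"
    and dom: "\<And>f. f \<in> V \<Longrightarrow> \<exists>B\<in>\<B>. (norm f)\<^sup>2 \<le> c * (LINT s|haar. (norm (B f s))\<^sup>2)"
  shows "\<exists>F. finite F \<and> F \<subseteq> V \<and> (\<forall>f\<in>V. \<exists>a. f = (\<Sum>g\<in>F. a g *\<^sub>R g))"
proof -
  define ip where "ip f g = (\<Sum>B\<in>\<B>. LINT s|haar. apply_bcontfun (blinfun_apply B f) s \<bullet> apply_bcontfun (blinfun_apply B g) s)" for f g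
  have int: "integrable haar (\<lambda>s. (B f s :: 'b) \<bullet> B g s)" for f g and B :: "(cantor \<Rightarrow>\<^sub>C 'b) \<Rightarrow>\<^sub>L (cantor \<Rightarrow>\<^sub>C 'b)"
    by (intro integrable_haar continuous_intros)
  have ip_lin: "linear (\<lambda>f. ip f g)" for g
    by (rule linearI)
      (simp_all add: ip_def blinfun.add_right blinfun.scaleR_right plus_bcontfun.rep_eq
        scaleR_bcontfun.rep_eq inner_add_left sum.distrib sum_distrib_left int)
  have ip_sym: "ip f g = ip g f" for f g
    by (simp add: ip_def inner_commute)
  have ip_norm: "(norm f)\<^sup>2 \<le> c * ip f f" if f: "f \<in> V" for f
  proof -
    obtain B where B: "B \<in> \<B>" "(norm f)\<^sup>2 \<le> c * (LINT s|haar. (norm (B f s))\<^sup>2)"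
      using dom[OF f] by blast
    have "(LINT s|haar. B f s \<bullet> B f s) \<le> ip f f"
      unfolding ip_def using B(1) \<open>finite \<B>\<close>
      by (intro member_le_sum[of B _ "\<lambda>B. LINT s|haar. B f s \<bullet> B f s"] Bochner_Integration.integral_nonneg) auto
    then show ?thesis
      using B(2) \<open>0 \<le> c\<close> by (simp add: power2_norm_eq_inner) (meson mult_left_mono order_trans)
  qed
  have ip_nonneg: "0 \<le> ip f f" for f
    unfolding ip_def by (intro sum_nonneg Bochner_Integration.integral_nonneg) auto
  define orth where "orth F \<longleftrightarrow> finite F \<and> F \<subseteq> V \<and> (\<forall>f\<in>F. \<forall>g\<in>F. ip f g = of_bool (f = g))" for F
  have ip_sum_left: "ip (\<Sum>f\<in>F. a f *\<^sub>R f) g = (\<Sum>f\<in>F. a f * ip f g)" for F a g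
    by (simp add: linear_sum[OF ip_lin] linear_scale[OF ip_lin])
  have card_le: "real (card F) \<le> (\<Sum>B\<in>\<B>. \<Sum>b\<in>(Basis :: 'b set). (norm B)\<^sup>2 * c)" if F: "orth F" for F
  proof -
    have pointwise: "(\<Sum>f\<in>F. (B f s \<bullet> b)\<^sup>2) \<le> (norm B)\<^sup>2 * c" if b: "b \<in> Basis"
      for B :: "(cantor \<Rightarrow>\<^sub>C 'b) \<Rightarrow>\<^sub>L (cantor \<Rightarrow>\<^sub>C 'b)" and s b
    proof -
      define a where "a f = B f s \<bullet> b" for f
      define g where "g = (\<Sum>f\<in>F. a f *\<^sub>R f)"
      define A where "A = (\<Sum>f\<in>F. (a f)\<^sup>2)"
      have g: "g \<in> V"
        unfolding g_def using F V by (intro subspace_sum subspace_scale) (auto simp: orth_def)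
      have ip_g: "ip g h = a h" if "h \<in> F" for h
      proof -
        have "ip g h = (\<Sum>f\<in>F. a f * of_bool (f = h))"
          unfolding g_def ip_sum_left using F that by (intro sum.cong) (auto simp: orth_def)
        then show ?thesis
          using F that by (simp add: orth_def of_bool_def if_distrib cong: if_cong)
      qed
      have "ip g g = (\<Sum>f\<in>F. a f * ip f g)"
        using ip_sum_left[where F = F and a = a and g = g] unfolding g_def[symmetric] .
      also have "\<dots> = A"
        unfolding A_def using ip_g by (intro sum.cong) (auto simp: ip_sym[of _ g] power2_eq_square)
      finally have norm_g: "(norm g)\<^sup>2 \<le> c * A"
        using ip_norm[OF g] by simp
      have lin: "linear (\<lambda>f. B f s \<bullet> b)"
        by (rule linearI)
          (simp_all add: blinfun.add_right blinfun.scaleR_right plus_bcontfun.rep_eq scaleR_bcontfun.rep_eq inner_add_left)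
      have "B g s \<bullet> b = A"
        unfolding g_def A_def linear_sum[OF lin] linear_scale[OF lin]
        by (simp add: a_def power2_eq_square)
      then have "A \<le> norm (B g s)"
        using Basis_le_norm[OF b, of "B g s"] by linarith
      also have "\<dots> \<le> norm B * norm g"
        using norm_bounded[of "B g" s] norm_blinfun[of B g] by linarith
      finally have "A\<^sup>2 \<le> (norm B * norm g)\<^sup>2"
        by (intro power_mono) (auto simp: A_def sum_nonneg)
      also have "\<dots> \<le> (norm B)\<^sup>2 * (c * A)"
        unfolding power_mult_distrib by (intro mult_left_mono norm_g) auto
      finally have "A * A \<le> ((norm B)\<^sup>2 * c) * A"
        by (simp add: power2_eq_square mult_ac)
      moreover have "0 \<le> A"
        by (simp add: A_def sum_nonneg)
      moreover have "0 \<le> (norm B)\<^sup>2 * c"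
        using \<open>0 \<le> c\<close> by simp
      ultimately have "A \<le> (norm B)\<^sup>2 * c"
        by (cases "A = 0") (auto simp: mult_le_cancel_right)
      then show ?thesis
        by (simp add: A_def a_def)
    qed
    have "real (card F) = (\<Sum>f\<in>F. ip f f)"
      using F by (simp add: orth_def)
    also have "\<dots> = (\<Sum>B\<in>\<B>. LINT s|haar. (\<Sum>f\<in>F. apply_bcontfun (blinfun_apply B f) s \<bullet> apply_bcontfun (blinfun_apply B f) s))"
      unfolding ip_def by (subst sum.swap) (simp add: int)
    also have "\<dots> \<le> (\<Sum>B\<in>\<B>. LINT s|haar. (\<Sum>b\<in>(Basis :: 'b set). (norm B)\<^sup>2 * c))"
    proof (intro sum_mono integral_mono)
      fix B :: "(cantor \<Rightarrow>\<^sub>C 'b) \<Rightarrow>\<^sub>L (cantor \<Rightarrow>\<^sub>C 'b)" and s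
      have "(\<Sum>f\<in>F. B f s \<bullet> B f s) = (\<Sum>b\<in>Basis. \<Sum>f\<in>F. (B f s \<bullet> b)\<^sup>2)"
        by (subst sum.swap) (simp add: norm_power2_eq_sum_Basis flip: power2_norm_eq_inner)
      also have "\<dots> \<le> (\<Sum>b\<in>(Basis :: 'b set). (norm B)\<^sup>2 * c)"
        by (intro sum_mono pointwise)
      finally show "(\<Sum>f\<in>F. B f s \<bullet> B f s) \<le> (\<Sum>b\<in>(Basis :: 'b set). (norm B)\<^sup>2 * c)" .
    qed (auto intro!: integrable_haar continuous_intros)
    finally show ?thesis
      using haar.prob_space by simp
  qed
  obtain F where F: "orth F" and max: "\<And>G. orth G \<Longrightarrow> card G \<le> card F"
  proof -
    define K where "K = (\<Sum>B\<in>\<B>. \<Sum>b\<in>(Basis :: 'b set). (norm B)\<^sup>2 * c)"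
    have "\<exists>F. orth F \<and> (\<forall>G. orth G \<longrightarrow> card G \<le> card F)"
    proof (rule ex_has_greatest_nat)
      show "orth {}" by (simp add: orth_def)
      show "\<forall>G. orth G \<longrightarrow> card G < Suc (nat \<lceil>K\<rceil>)"
      proof (intro allI impI)
        fix G assume "orth G"
        then have "real (card G) \<le> K" unfolding K_def by (rule card_le)
        then show "card G < Suc (nat \<lceil>K\<rceil>)" by linarith
      qed
    qed
    then show thesis using that by blast
  qed
  have "f = (\<Sum>g\<in>F. ip f g *\<^sub>R g)" if f: "f \<in> V" for f
  proof (rule ccontr)
    define r where "r = f - (\<Sum>g\<in>F. ip f g *\<^sub>R g)"
    assume "f \<noteq> (\<Sum>g\<in>F. ip f g *\<^sub>R g)"
    then have "r \<noteq> 0" by (simp add: r_def)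
    have r: "r \<in> V"
      unfolding r_def using F V f by (intro subspace_diff subspace_sum subspace_scale) (auto simp: orth_def)
    have "0 < (norm r)\<^sup>2" using \<open>r \<noteq> 0\<close> by simp
    then have "ip r r \<noteq> 0"
      using ip_norm[OF r] by auto
    then have pos: "0 < ip r r"
      using ip_nonneg[of r] by simp
    have ip_r: "ip r h = 0" if "h \<in> F" for h
    proof -
      have "(\<Sum>g\<in>F. ip f g * ip g h) = (\<Sum>g\<in>F. ip f g * of_bool (g = h))"
        using F that by (intro sum.cong) (auto simp: orth_def)
      also have "\<dots> = ip f h"
        using F that by (simp add: orth_def of_bool_def if_distrib cong: if_cong)
      finally show ?thesis
        by (simp add: r_def linear_diff[OF ip_lin] ip_sum_left)
    qed
    define u where "u = (1 / sqrt (ip r r)) *\<^sub>R r"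
    have ip_u: "ip u h = ip r h / sqrt (ip r r)" for h
      by (simp add: u_def linear_scale[OF ip_lin])
    have "ip u u = 1"
      using pos by (simp add: ip_u ip_sym[of r u]) 
    have u: "u \<in> V"
      unfolding u_def using V r by (rule subspace_scale)
    have "ip u h = 0" if "h \<in> F" for h
      using ip_r[OF that] by (simp add: ip_u)
    moreover from this have "u \<notin> F"
      using \<open>ip u u = 1\<close> by force
    ultimately have "orth (insert u F)"
      using F u \<open>ip u u = 1\<close> ip_sym by (auto simp: orth_def)
    then have "card (insert u F) \<le> card F"
      by (rule max)
    then show False
      using F \<open>u \<notin> F\<close> by (simp add: orth_def)
  qed
  then show ?thesis
    using F unfolding orth_def by blast
qed

text \<open>
  If \<open>T \<circ> S\<close> is an isomorphism on \<open>Z\<close>, then the image \<open>V\<close> of \<open>S\<close> carries a supremum norm that is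
  dominated by \<open>T\<close>, hence with \<open>e\<close> small enough by the vectors \<open>U (B f)\<close> and so by \<open>L\<^sub>2\<close> norms. The finite spanning
  set of \<open>V\<close> is pulled back along \<open>S\<close>.
\<close>

lemma strictly_singular_dominated:
  fixes U T :: "'k::{real_normed_field, euclidean_space} cantor_op"
  assumes T: "T \<in> dominated_ideal U"
    and U: "\<And>g. (norm (U g))\<^sup>2 \<le> (LINT s|haar. (norm (g s))\<^sup>2)"
  shows "strictly_singular C_cantor C_cantor (blinfun_apply T)"
  unfolding strictly_singular_def
proof (intro conjI notI)
  show "operator C_cantor C_cantor (blinfun_apply T)"
    using T by (simp add: dominated_ideal_def L_C_cantor_def)
  assume "\<exists>(Z :: ('k, cantor \<Rightarrow>\<^sub>C 'k) normed_space) S. is_banach_space Z \<and> infinite_dimensional Z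
    \<and> operator Z C_cantor S \<and> isomorphism_onto_image Z C_cantor (blinfun_apply T \<circ> S)"
  then obtain Z :: "('k, cantor \<Rightarrow>\<^sub>C 'k) normed_space" and S where
    Z: "is_banach_space Z" "infinite_dimensional Z" and S: "operator Z C_cantor S"
    and iso: "isomorphism_onto_image Z C_cantor (blinfun_apply T \<circ> S)"
    by blast
  have normed: "is_normed_space Z"
    using Z(1) by (simp add: is_banach_space_def)
  interpret Z: Module.module scalars Z
    using normed by (simp add: is_normed_space_def)
  have nrm_nonneg: "0 \<le> nrm Z z" if "z \<in> carrier Z" for z
    using normed that by (simp add: is_normed_space_def)
  have smult: "c \<odot>\<^bsub>Z\<^esub> z \<in> carrier Z" if "z \<in> carrier Z" for c z
    using Z.smult_closed[of c z] that by (simp add: scalars_def)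
  have S_add: "S (x \<oplus>\<^bsub>Z\<^esub> y) = S x + S y" if "x \<in> carrier Z" "y \<in> carrier Z" for x y
    using S that by (simp add: operator_def C_cantor_def)
  have S_smult: "S (of_real r \<odot>\<^bsub>Z\<^esub> x) = r *\<^sub>R S x" if "x \<in> carrier Z" for r x
    using S that by (simp add: operator_def C_cantor_def pointwise_scale_of_real)
  have "\<exists>L. \<forall>z\<in>carrier Z. norm (S z) \<le> L * nrm Z z"
    using S by (simp add: operator_def C_cantor_def)
  then obtain L where L: "\<And>z. z \<in> carrier Z \<Longrightarrow> norm (S z) \<le> L * nrm Z z"
    by blast
  have inj_TS: "inj_on (blinfun_apply T \<circ> S) (carrier Z)"
    using iso by (simp add: isomorphism_onto_image_def)
  then have inj: "inj_on S (carrier Z)"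
    by (rule inj_on_imageI2)
  have "\<exists>K. \<forall>y\<in>(blinfun_apply T \<circ> S) ` carrier Z.
      nrm Z (inv_into (carrier Z) (blinfun_apply T \<circ> S) y) \<le> K * norm y"
    using iso unfolding isomorphism_onto_image_def operator_def C_cantor_def by simp
  then obtain K where "\<And>y. y \<in> (blinfun_apply T \<circ> S) ` carrier Z \<Longrightarrow>
      nrm Z (inv_into (carrier Z) (blinfun_apply T \<circ> S) y) \<le> K * norm y"
    by blast
  then have K: "nrm Z z \<le> K * norm (T (S z))" if "z \<in> carrier Z" for z
    using inv_into_f_f[OF inj_TS that] that by (metis comp_apply imageI)

  define V where "V = S ` carrier Z"
  have S_zero: "S \<zero>\<^bsub>Z\<^esub> = 0"
    using S_add[of "\<zero>\<^bsub>Z\<^esub>" "\<zero>\<^bsub>Z\<^esub>"] by simp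
  have V: "subspace V"
  proof (rule subspaceI)
    show "0 \<in> V"
      unfolding V_def using S_zero Z.zero_closed by (metis imageI)
    show "x + y \<in> V" if "x \<in> V" "y \<in> V" for x y
      using that S_add Z.a_closed unfolding V_def by (metis (no_types, lifting) imageE imageI)
    show "r *\<^sub>R x \<in> V" if "x \<in> V" for r x
      using that S_smult smult unfolding V_def by (metis (no_types, lifting) imageE imageI)
  qed

  define P where "P = \<bar>L\<bar> * \<bar>K\<bar> + 1"
  have "0 < P" by (simp add: P_def add_nonneg_pos)
  have P: "norm f \<le> P * norm (T f)" if f: "f \<in> V" for f
  proof -
    obtain z where z: "z \<in> carrier Z" "f = S z"
      using f by (auto simp: V_def)
    have "norm f \<le> \<bar>L\<bar> * nrm Z z"
      using L[OF z(1)] mult_right_mono[OF abs_ge_self[of L] nrm_nonneg[OF z(1)]] z(2) by simp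
    also have "\<dots> \<le> \<bar>L\<bar> * (\<bar>K\<bar> * norm (T f))"
      using K[OF z(1)] mult_right_mono[OF abs_ge_self[of K] norm_ge_zero[of "T f"]] z(2)
      by (intro mult_left_mono) simp_all
    also have "\<dots> \<le> P * norm (T f)"
      by (simp add: P_def distrib_right)
    finally show ?thesis .
  qed
  have eps: "0 < 1 / (2 * P)" using \<open>0 < P\<close> by simp
  obtain \<B> :: "'k cantor_op set" and C where \<B>: "finite \<B>" "0 \<le> C"
    "\<And>f. \<exists>B\<in>\<B>. norm (T f) \<le> C * norm (U (B f)) + 1 / (2 * P) * norm f"
    using dominated_idealD[OF T eps] by metis
  have dom: "\<exists>B\<in>\<B>. (norm f)\<^sup>2 \<le> (2 * P * C)\<^sup>2 * (LINT s|haar. (norm (B f s))\<^sup>2)" if f: "f \<in> V" for f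
  proof -
    obtain B where B: "B \<in> \<B>" "norm (T f) \<le> C * norm (U (B f)) + 1 / (2 * P) * norm f"
      using \<B>(3) by blast
    have "norm f \<le> P * (C * norm (U (B f)) + 1 / (2 * P) * norm f)"
      using P[OF f] B(2) \<open>0 < P\<close> mult_left_mono[OF B(2), of P] by linarith
    also have "\<dots> = P * C * norm (U (B f)) + norm f / 2"
      using \<open>0 < P\<close> by (simp add: field_simps)
    finally have "norm f \<le> 2 * P * C * norm (U (B f))" by simp
    then have "(norm f)\<^sup>2 \<le> (2 * P * C * norm (U (B f)))\<^sup>2"
      by (intro power_mono) auto
    also have "\<dots> \<le> (2 * P * C)\<^sup>2 * (LINT s|haar. (norm (B f s))\<^sup>2)"
      unfolding power_mult_distrib[of "2 * P * C"] by (intro mult_left_mono U) auto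
    finally show ?thesis using B(1) by blast
  qed
  have "\<exists>F. finite F \<and> F \<subseteq> V \<and> (\<forall>f\<in>V. \<exists>a. f = (\<Sum>g\<in>F. a g *\<^sub>R g))"
    by (rule finite_dim_if_L2_dominates[OF V \<B>(1) zero_le_power2 dom])
  then obtain F where F: "finite F" "F \<subseteq> V" "\<And>f. f \<in> V \<Longrightarrow> \<exists>a. f = (\<Sum>g\<in>F. a g *\<^sub>R g)"
    by blast

  let ?B = "inv_into (carrier Z) S ` F"
  have S_inv: "S (inv_into (carrier Z) S g) = g" "inv_into (carrier Z) S g \<in> carrier Z" if "g \<in> F" for g
    using that F(2) unfolding V_def by (auto simp: f_inv_into_f inv_into_into subset_iff)
  have S_finsum: "S (finsum Z h A) = (\<Sum>x\<in>A. S (h x))" if "finite A" "h \<in> A \<rightarrow> carrier Z" for h and A :: "(cantor \<Rightarrow>\<^sub>C 'k) set"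
    using that
  proof (induction A rule: finite_induct)
    case (insert x A)
    then have "finsum Z h A \<in> carrier Z"
      by (intro Z.finsum_closed) auto
    then show ?case
      using insert by (subst Z.finsum_insert) (auto simp: S_add)
  qed (simp add: S_zero)
  have "\<exists>c. x = (\<Oplus>\<^bsub>Z\<^esub>b\<in>?B. c b \<odot>\<^bsub>Z\<^esub> b)" if x: "x \<in> carrier Z" for x
  proof -
    obtain a where a: "S x = (\<Sum>g\<in>F. a g *\<^sub>R g)"
      using F(3)[of "S x"] x by (auto simp: V_def)
    let ?c = "\<lambda>b. of_real (a (S b)) :: 'k"
    have closed: "(\<lambda>b. ?c b \<odot>\<^bsub>Z\<^esub> b) \<in> ?B \<rightarrow> carrier Z"
      using S_inv smult by auto
    have "S (\<Oplus>\<^bsub>Z\<^esub>b\<in>?B. ?c b \<odot>\<^bsub>Z\<^esub> b) = (\<Sum>b\<in>?B. a (S b) *\<^sub>R S b)"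
      using F(1) closed S_inv by (subst S_finsum) (auto intro!: sum.cong S_smult)
    also have "\<dots> = (\<Sum>g\<in>F. a g *\<^sub>R g)"
      using S_inv by (subst sum.reindex) (auto intro!: inj_on_inverseI[of _ S] sum.cong)
    also have "\<dots> = S x"
      by (rule a[symmetric])
    finally have eq: "S (\<Oplus>\<^bsub>Z\<^esub>b\<in>?B. ?c b \<odot>\<^bsub>Z\<^esub> b) = S x" .
    have "(\<Oplus>\<^bsub>Z\<^esub>b\<in>?B. ?c b \<odot>\<^bsub>Z\<^esub> b) = x"
      by (rule inj_onD[OF inj eq Z.finsum_closed[OF closed] x])
    then show ?thesis by (intro exI) (rule sym)
  qed
  moreover have "finite ?B" "?B \<subseteq> carrier Z"
    using F(1) S_inv by auto
  ultimately show False
    using Z(2) unfolding infinite_dimensional_def by blast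
qed

section \<open>A continuum of ideals\<close>

lemma square_le_exp: "4 \<le> n \<Longrightarrow> n * n \<le> (2::nat) ^ n"
proof (induction n rule: nat_induct_at_least)
  case (Suc n)
  have "4 * n \<le> n * n" using Suc.hyps by (rule mult_le_mono1)
  moreover have "Suc n * Suc n = n * n + 2 * n + 1" by simp
  ultimately have "Suc n * Suc n \<le> 2 * (n * n)" using Suc.hyps by linarith
  then show ?case using Suc.IH by simp
qed simp

text \<open>
  The final comparison: a fixed power of a fixed multiple of \<open>D\<close> is below \<open>D ^ n\<close> for large \<open>n\<close> and
  \<open>D \<ge> n\<close>. The parameters \<open>b\<close>, \<open>c\<close>, \<open>L\<close> and \<open>s\<close> will depend on the two ideals but not on \<open>n\<close>.
\<close>

lemma block_size_wins:
  fixes b c L s :: nat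
  shows "\<exists>N. \<forall>n\<ge>N. \<forall>D\<ge>n. c * (D + 2) + 1 \<le> 2 ^ D \<and> ((D * b + b * (c * (D + 2))) * L + 1) ^ s < D ^ n"
proof (intro exI allI impI conjI)
  define A where "A = (b + 3 * b * c) * L + 3 * c + 4"
  fix n D assume n: "A + 2 * s + 1 \<le> n" and D: "n \<le> D"
  have "4 \<le> A" "A \<le> D" using n D by (auto simp: A_def)
  then have D4: "4 \<le> D" by simp
  have "c * (D + 2) + 1 \<le> (3 * c + 4) * D"
    using D4 mult_le_mono2[of "D + 2" "3 * D" c] by (simp add: algebra_simps)
  also have "\<dots> \<le> A * D"
    by (intro mult_le_mono1) (simp add: A_def)
  also have "\<dots> \<le> D * D"
    using \<open>A \<le> D\<close> by (rule mult_le_mono1)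
  also have "\<dots> \<le> 2 ^ D"
    using D4 by (rule square_le_exp)
  finally show "c * (D + 2) + 1 \<le> 2 ^ D" .
  have "b * (c * (D + 2)) \<le> b * (c * (3 * D))"
    using D4 by (intro mult_le_mono2) simp
  then have "(D * b + b * (c * (D + 2))) * L + 1 \<le> (D * b + b * (c * (3 * D))) * L + 4 * D"
    using D4 by (intro add_mono mult_le_mono1 order_refl) auto
  also have "\<dots> \<le> A * D"
    by (simp add: A_def algebra_simps)
  also have "\<dots> \<le> D * D"
    using \<open>A \<le> D\<close> by (rule mult_le_mono1)
  finally have "((D * b + b * (c * (D + 2))) * L + 1) ^ s \<le> (D * D) ^ s"
    by (rule power_mono) simp
  also have "\<dots> = D ^ (2 * s)"
    by (simp add: power_mult power2_eq_square)
  also have "\<dots> < D ^ n"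
    using D4 n by (intro power_strict_increasing) auto
  finally show "((D * b + b * (c * (D + 2))) * L + 1) ^ s < D ^ n" .
qed

text \<open>
  The family \<open>E n\<close> uses the coordinates from \<open>D n\<close> up to \<open>D (Suc n)\<close>. The bound \<open>2 ^ D n\<close> serves twice:
  it is the number of all characters on the coordinates before the block, hence bounds the total size of
  the earlier families, and the order of independence in the block.
\<close>

locale walsh_blocks =
  fixes D :: "nat \<Rightarrow> nat" and E :: "nat \<Rightarrow> nat set set"
  assumes D_Suc: "n + 2 ^ D n \<le> D (Suc n)"
    and E_subset: "E n \<subseteq> Pow {D n..<D (Suc n)}"
    and E_independent: "independent_upto (2 ^ D n) (E n)"
    and card_E: "D (Suc n) ^ n \<le> card (E n)"
begin

lemma D_mono:
  assumes "m \<le> n"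
  shows "D m \<le> D n"
proof (rule lift_Suc_mono_le[OF _ assms])
  show "D n \<le> D (Suc n)" for n
    using D_Suc[of n] less_exp[of "D n"] by linarith
qed

lemma finite_word: "x \<in> E n \<Longrightarrow> finite x"
  using E_subset[of n] finite_subset by blast

lemma blocks_disjoint:
  assumes "x \<in> E m" "y \<in> E n" "m \<noteq> n" "i \<in> x"
  shows "i \<notin> y"
  using assms(3)
proof (cases m n rule: linorder_cases)
  case less
  then show ?thesis
    using E_subset[of m] E_subset[of n] D_mono[of "Suc m" n] assms by fastforce
next
  case greater
  then show ?thesis
    using E_subset[of m] E_subset[of n] D_mono[of "Suc n" m] assms by fastforce
qed simp

lemma card_early_blocks: "finite (\<Union>m<n. E m)" "card (\<Union>m<n. E m) \<le> 2 ^ D n"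
proof -
  have sub: "(\<Union>m<n. E m) \<subseteq> Pow {..<D n}"
  proof
    fix x assume "x \<in> (\<Union>m<n. E m)"
    then obtain m where m: "m < n" "x \<in> E m" by blast
    then have "x \<subseteq> {D m..<D (Suc m)}"
      using E_subset by blast
    then show "x \<in> Pow {..<D n}"
      using D_mono[of "Suc m" n] m by fastforce
  qed
  then show "finite (\<Union>m<n. E m)"
    by (rule finite_subset) simp
  show "card (\<Union>m<n. E m) \<le> 2 ^ D n"
    using card_mono[OF _ sub] by (simp add: card_Pow)
qed

text \<open>
  The part of \<open>S\<close> in one block has a coordinate of odd multiplicity by independence in the block. Words of
  other blocks do not contain this coordinate, so its multiplicity in \<open>S\<close> is the same.
\<close>

lemma late_blocks_independent: "independent_upto (2 ^ D (Suc n)) (\<Union>m\<in>{n<..}. E m)"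
  unfolding independent_upto_def
proof (intro allI impI)
  fix S assume S: "S \<subseteq> (\<Union>m\<in>{n<..}. E m)" "S \<noteq> {}" "finite S" "card S \<le> 2 ^ D (Suc n)"
  then obtain x m where m: "x \<in> S" "x \<in> E m" "n < m" by blast
  have "card (S \<inter> E m) \<le> card S"
    using S(3) by (intro card_mono) auto
  also have "\<dots> \<le> 2 ^ D m"
    using S(4) D_mono[of "Suc n" m] m(3) by (meson Suc_leI one_le_numeral order_trans power_increasing)
  finally have "card (S \<inter> E m) \<le> 2 ^ D m" .
  moreover have "S \<inter> E m \<subseteq> E m" "S \<inter> E m \<noteq> {}" "finite (S \<inter> E m)"
    using m(1,2) S(3) by auto
  ultimately obtain i where i: "odd (card {x \<in> S \<inter> E m. i \<in> x})"
    using E_independent[of m] unfolding independent_upto_def by blast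
  have "{x \<in> S \<inter> E m. i \<in> x} \<noteq> {}"
  proof
    assume "{x \<in> S \<inter> E m. i \<in> x} = {}"
    then have "card {x \<in> S \<inter> E m. i \<in> x} = 0"
      by (simp only: card.empty)
    then show False using i by simp
  qed
  then obtain y where y: "y \<in> E m" "i \<in> y" by blast
  have "x \<in> E m" if x: "x \<in> S" "i \<in> x" for x
  proof -
    obtain m' where "x \<in> E m'" using x S(1) by blast
    then show ?thesis
      using blocks_disjoint[OF y(1) _ _ y(2), of x m'] x(2) by (cases "m = m'") auto
  qed
  then have eq: "{x \<in> S. i \<in> x} = {x \<in> S \<inter> E m. i \<in> x}" by blast
  show "\<exists>i. odd (card {x \<in> S. i \<in> x})"
    using i unfolding eq[symmetric] by (rule exI)
qed

text \<open>
  The bound of \<open>card_large_coefs_le\<close> needs independence, which is available for at most \<open>2 ^ D (Suc n)\<close>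
  characters. As the bound is smaller than this number, a larger set \<open>Q\<close> would contain
  a subset of size just above the bound, a contradiction.
\<close>

lemma few_late_coefs:
  fixes B :: "'k::{real_normed_field, euclidean_space} cantor_op"
  assumes "0 < \<delta>" "0 < \<beta>" "norm B \<le> \<beta>"
    and c: "8 * (real DIM('k) * \<beta> / \<delta>)\<^sup>2 \<le> real c" "c * (D (Suc n) + 2) + 1 \<le> 2 ^ D (Suc n)"
    and Q: "Q \<subseteq> (\<Union>m\<in>{n<..}. E m)"
      "\<And>x. x \<in> Q \<Longrightarrow> \<exists>k\<in>E n. \<exists>l\<in>E n. \<delta> \<le> norm (coef x (B (walsh_fn k - walsh_fn l)))"
  shows "finite Q \<and> card Q \<le> c * (D (Suc n) + 2)"
proof (rule finite_if_finite_subsets_card_bdd)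
  let ?N = "c * (D (Suc n) + 2)"
  have small: "card R \<le> ?N" if R: "R \<subseteq> Q" "finite R" "card R \<le> 2 ^ D (Suc n)" for R
  proof -
    obtain k l where kl: "\<And>x. x \<in> Q \<Longrightarrow> k x \<in> E n" "\<And>x. x \<in> Q \<Longrightarrow> l x \<in> E n"
      "\<And>x. x \<in> Q \<Longrightarrow> \<delta> \<le> norm (coef x (B (walsh_fn (k x) - walsh_fn (l x))))"
      using Q(2) by metis
    have below: "i < D (Suc n)" if "y \<in> E n" "i \<in> y" for y i
    proof -
      have "y \<subseteq> {D n..<D (Suc n)}"
        using E_subset that(1) by blast
      then show ?thesis using that(2) by auto
    qed
    have "real (card R) \<le> 8 * (real DIM('k) * \<beta> / \<delta>)\<^sup>2 * (real (D (Suc n)) + 2)"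
    proof (rule card_large_coefs_le[where \<gamma> = "\<lambda>x s. walsh (k x) s - walsh (l x) s"
          and g = "\<lambda>x. walsh_fn (k x) - walsh_fn (l x)" and u = 1 and B = B])
      show "independent_upto (card R) R"
        using late_blocks_independent[of n] by (rule independent_upto_subset) (use R Q(1) in auto)
      show "walsh (k x) s - walsh (l x) s = walsh (k x) t - walsh (l x) t"
        if "x \<in> R" "\<forall>i<D (Suc n). s i = t i" for x s t
      proof -
        have "x \<in> Q" using that R by blast
        moreover have "walsh y s = walsh y t" if y: "y \<in> E n" for y
          using below[OF y] \<open>\<forall>i<D (Suc n). s i = t i\<close> by (intro walsh_cong) blast
        ultimately have "walsh (k x) s = walsh (k x) t" "walsh (l x) s = walsh (l x) t"
          using kl(1,2) by blast+
        then show ?thesis by simp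
      qed
      show "\<bar>walsh (k x) s - walsh (l x) s\<bar> \<le> 2" for x s
        using abs_walsh[of "k x" s] abs_walsh[of "l x" s] by linarith
      show "apply_bcontfun (walsh_fn (k x) - walsh_fn (l x)) s = (walsh (k x) s - walsh (l x) s) *\<^sub>R (1 :: 'k)" for x s
        by (simp add: minus_bcontfun.rep_eq scaleR_diff_left flip: of_real_def)
      show "finite x" if "x \<in> R" for x
        using that R Q(1) finite_word by blast
    qed (use assms R kl(3) in auto)
    also have "\<dots> \<le> real c * (real (D (Suc n)) + 2)"
      using c(1) by (rule mult_right_mono) simp
    also have "\<dots> = real ?N" by (simp add: algebra_simps)
    finally show ?thesis by (simp only: of_nat_le_iff)
  qed
  fix G assume G: "finite G" "G \<subseteq> Q"
  show "card G \<le> ?N"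
  proof (rule ccontr)
    assume "\<not> card G \<le> ?N"
    then obtain R where R: "R \<subseteq> G" "card R = ?N + 1" "finite R"
      using obtain_subset_with_card_n[of "?N + 1" G] by (metis Suc_eq_plus1 not_less_eq_eq)
    then have "card R \<le> ?N"
      using c(2) G by (intro small) auto
    then show False using R(2) by simp
  qed
qed

text \<open>
  The set \<open>J\<close> contains all pairs \<open>(x, B)\<close> at which some \<open>B (w\<^sub>k - w\<^sub>l)\<close> with \<open>k\<close>, \<open>l\<close> in \<open>E n\<close> can have a large
  coefficient: the characters from blocks before the \<open>n\<close>-th one, all of them, and those from later blocks that do occur. Since
  \<open>n \<notin> M\<close>, these pairs separate the coefficient vectors \<open>X k\<close>.
\<close>

lemma card_block_le:
  fixes \<B> :: "'k::{real_normed_field, euclidean_space} cantor_op set"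
  assumes "n \<notin> M" "finite \<B>" and \<delta>: "0 < \<delta>" and \<beta>: "0 < \<beta>" "\<And>B. B \<in> \<B> \<Longrightarrow> norm B \<le> \<beta>"
    and c: "8 * (real DIM('k) * \<beta> / \<delta>)\<^sup>2 \<le> real c" "c * (D (Suc n) + 2) + 1 \<le> 2 ^ D (Suc n)"
    and s: "real (card \<B>) * (\<beta> / (\<delta> / 2))\<^sup>2 \<le> real s"
    and sep: "\<And>k l. k \<in> E n \<Longrightarrow> l \<in> E n \<Longrightarrow> k \<noteq> l \<Longrightarrow>
      \<exists>x\<in>(\<Union>m\<in>M. E m). \<exists>B\<in>\<B>. \<delta> \<le> norm (coef x (B (walsh_fn k - walsh_fn l)))"
    and q: "finite Z" "\<And>z :: 'k. norm z \<le> \<beta> \<Longrightarrow> q z \<in> Z" "\<And>z. norm z \<le> \<beta> \<Longrightarrow> norm (z - q z) < \<delta> / 2"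
  shows "card (E n) \<le> ((D (Suc n) * card \<B> + card \<B> * (c * (D (Suc n) + 2))) * card Z + 1) ^ s"
proof -
  let ?N = "c * (D (Suc n) + 2)"
  define Q where "Q B = {x \<in> (\<Union>m\<in>{n<..}. E m).
    \<exists>k\<in>E n. \<exists>l\<in>E n. \<delta> \<le> norm (coef x (blinfun_apply B (walsh_fn k - walsh_fn l)))}" for B :: "'k cantor_op"
  define P where "P B = (\<Union>m<n. E m) \<union> Q B" for B
  define J where "J = (\<Union>B\<in>\<B>. P B \<times> {B})"
  define X :: "nat set \<Rightarrow> nat set \<times> 'k cantor_op \<Rightarrow> 'k"
    where "X k i = coef (fst i) (blinfun_apply (snd i) (walsh_fn k))" for k i
  have Q: "finite (Q B) \<and> card (Q B) \<le> ?N" if "B \<in> \<B>" for B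
  proof (rule few_late_coefs[OF \<delta> \<beta>(1) \<beta>(2)[OF that] c])
    show "Q B \<subseteq> (\<Union>m\<in>{n<..}. E m)"
      unfolding Q_def by blast
    show "\<exists>k\<in>E n. \<exists>l\<in>E n. \<delta> \<le> norm (coef x (B (walsh_fn k - walsh_fn l)))" if "x \<in> Q B" for x
      using that unfolding Q_def by blast
  qed
  have P_fin: "finite (P B)" if "B \<in> \<B>" for B
    using Q that card_early_blocks by (simp add: P_def)
  have "card (P B) \<le> D (Suc n) + ?N" if "B \<in> \<B>" for B
  proof -
    have "card (P B) \<le> card (\<Union>m<n. E m) + card (Q B)"
      unfolding P_def by (rule card_Un_le)
    then show ?thesis
      using card_early_blocks(2)[of n] Q[OF that] D_Suc[of n] by linarith
  qed
  then have "card J \<le> (\<Sum>B\<in>\<B>. D (Suc n) + ?N)"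
    unfolding J_def using \<open>finite \<B>\<close>
    by (intro order_trans[OF card_UN_le] sum_mono) (simp_all add: card_cartesian_product)
  then have card_J: "card J \<le> D (Suc n) * card \<B> + card \<B> * ?N"
    by (simp add: algebra_simps)
  have J_fin: "finite J"
    using \<open>finite \<B>\<close> P_fin by (simp add: J_def)
  have J_finite_word: "finite x" if "(x, B) \<in> J" for x B
    using that finite_word by (auto simp: J_def P_def Q_def)
  have norm_image: "norm (B (walsh_fn k)) \<le> \<beta>" if "B \<in> \<B>" for B k
  proof -
    have "norm (B (walsh_fn k)) \<le> norm B * norm (walsh_fn k :: cantor \<Rightarrow>\<^sub>C 'k)"
      by (rule norm_blinfun)
    also have "\<dots> \<le> norm B * 1"
      by (intro mult_left_mono norm_walsh_fn) simp
    finally show ?thesis using \<beta>(2)[OF that] by simp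
  qed
  have norm_X: "norm (X k i) \<le> \<beta>" if iJ: "i \<in> J" for k i
  proof -
    obtain x B where i: "i = (x, B)" "B \<in> \<B>" "finite x"
      using iJ J_finite_word by (cases i) (auto simp: J_def)
    then show ?thesis
      using norm_coef_le[OF i(3), of "B (walsh_fn k)"] norm_image[OF i(2), of k] by (simp add: X_def)
  qed
  have "card (E n) \<le> (card J * card Z + 1) ^ s"
  proof (rule card_separated_le[where \<eta> = "\<delta> / 2" and X = X and q = q])
    fix k l assume kl: "k \<in> E n" "l \<in> E n" "k \<noteq> l"
    then obtain x B m where x: "m \<in> M" "x \<in> E m" "B \<in> \<B>" "\<delta> \<le> norm (coef x (B (walsh_fn k - walsh_fn l)))"
      using sep by blast
    have "m \<noteq> n" using x(1) \<open>n \<notin> M\<close> by blast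
    then have "x \<in> P B"
      using x kl unfolding P_def Q_def by (cases m n rule: linorder_cases) auto
    then have "(x, B) \<in> J"
      using x by (auto simp: J_def)
    moreover have "X k (x, B) - X l (x, B) = coef x (B (walsh_fn k - walsh_fn l))"
      by (simp add: X_def blinfun.diff_right linear_diff[OF linear_coef])
    ultimately show "\<exists>i\<in>J. 2 * (\<delta> / 2) \<le> norm (X k i - X l i)"
      using x(4) by (intro bexI[of _ "(x, B)"]) auto
  next
    fix k
    let ?A = "\<lambda>B. {x \<in> P B. \<delta> / 2 \<le> norm (X k (x, B))}"
    have "real (card (?A B)) \<le> (\<beta> / (\<delta> / 2))\<^sup>2" if B: "B \<in> \<B>" for B
    proof -
      have "real (card (?A B)) * (\<delta> / 2)\<^sup>2 = (\<Sum>x\<in>?A B. (\<delta> / 2)\<^sup>2)" by simp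
      also have "\<dots> \<le> (\<Sum>x\<in>?A B. (norm (coef x (B (walsh_fn k))))\<^sup>2)"
        using \<delta> by (intro sum_mono power_mono) (auto simp: X_def)
      also have "\<dots> \<le> (norm (B (walsh_fn k)))\<^sup>2"
      proof (rule order_trans[OF bessel L2_le_norm])
        show "finite (?A B)" using P_fin[OF B] by simp
        show "finite x" if "x \<in> ?A B" for x
          using that B by (intro J_finite_word[of x B]) (auto simp: J_def)
      qed
      also have "\<dots> \<le> \<beta>\<^sup>2"
        by (intro power_mono norm_image[OF B]) simp
      finally show ?thesis
        using \<delta> by (simp add: field_simps power_divide)
    qed
    then have "(\<Sum>B\<in>\<B>. real (card (?A B))) \<le> (\<Sum>B\<in>\<B>. (\<beta> / (\<delta> / 2))\<^sup>2)"
      by (rule sum_mono)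
    then have "real (\<Sum>B\<in>\<B>. card (?A B)) \<le> real s"
      using s by simp
    then have le: "(\<Sum>B\<in>\<B>. card (?A B)) \<le> s"
      by (simp only: of_nat_le_iff)
    have eq: "{i \<in> J. \<delta> / 2 \<le> norm (X k i)} = (\<Union>B\<in>\<B>. ?A B \<times> {B})"
      by (auto simp: J_def)
    have "card {i \<in> J. \<delta> / 2 \<le> norm (X k i)} \<le> (\<Sum>B\<in>\<B>. card (?A B \<times> {B}))"
      unfolding eq by (rule card_UN_le[OF \<open>finite \<B>\<close>])
    also have "\<dots> \<le> s"
      using le by (simp add: card_cartesian_product)
    finally show "card {i \<in> J. \<delta> / 2 \<le> norm (X k i)} \<le> s" .
  qed (use J_fin q norm_X in auto)
  also have "\<dots> \<le> ((D (Suc n) * card \<B> + card \<B> * ?N) * card Z + 1) ^ s"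
    using card_J by (intro power_mono add_mono mult_le_mono1) auto
  finally show ?thesis .
qed

text \<open>
  All constants are fixed by the domination inequality for \<open>e = 1 / 4\<close> before \<open>n \<in> M - M'\<close> is chosen.
\<close>

lemma walsh_op_not_dominated:
  assumes "infinite (M - M')"
  shows "(walsh_op (\<Union>n\<in>M. E n) :: 'k::{real_normed_field, euclidean_space} cantor_op)
    \<notin> dominated_ideal (walsh_op (\<Union>n\<in>M'. E n))"
proof
  let ?T = "walsh_op (\<Union>n\<in>M. E n) :: 'k cantor_op" and ?U = "walsh_op (\<Union>n\<in>M'. E n) :: 'k cantor_op"
  assume T: "?T \<in> dominated_ideal ?U"
  have "0 < (1 / 4 :: real)" by simp
  then obtain \<B> :: "'k cantor_op set" and C where \<B>: "finite \<B>" and "0 \<le> C"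
    and dom: "\<And>f. \<exists>B\<in>\<B>. norm (?T f) \<le> C * norm (?U (B f)) + 1 / 4 * norm f"
    using dominated_idealD[OF T] by metis
  \<comment> \<open>\<open>C + 1\<close> instead of \<open>C\<close> avoids the division by 0.\<close>
  define \<delta> where "\<delta> = 1 / (4 * (C + 1))"
  define \<beta> where "\<beta> = 1 + (\<Sum>B\<in>\<B>. norm B)"
  have \<delta>: "0 < \<delta>" using \<open>0 \<le> C\<close> by (simp add: \<delta>_def)
  have "0 < \<beta>" by (simp add: \<beta>_def add_pos_nonneg sum_nonneg)
  have \<beta>: "norm B \<le> \<beta>" if "B \<in> \<B>" for B
    using member_le_sum[OF that _ \<B>, of norm] by (simp add: \<beta>_def)
  have sep: "\<exists>x\<in>(\<Union>m\<in>M'. E m). \<exists>B\<in>\<B>. \<delta> \<le> norm (coef x (B (walsh_fn k - walsh_fn l)))"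
    if "n \<in> M" and kl: "k \<in> E n" "l \<in> E n" "k \<noteq> l" for n k l
  proof -
    let ?f = "walsh_fn k - walsh_fn l :: cantor \<Rightarrow>\<^sub>C 'k"
    obtain B where B: "B \<in> \<B>" "norm (?T ?f) \<le> C * norm (?U (B ?f)) + 1 / 4 * norm ?f"
      using dom by blast
    have "coef k ?f = 1"
      using kl finite_word by (simp add: linear_diff[OF linear_coef] coef_walsh_fn)
    then have "1 \<le> norm (?T ?f)"
      using norm_coef_le_walsh_op[of k "\<Union>n\<in>M. E n" ?f] kl \<open>n \<in> M\<close> finite_word by fastforce
    moreover have "norm ?f \<le> 2"
      using norm_triangle_ineq4[of "walsh_fn k :: cantor \<Rightarrow>\<^sub>C 'k" "walsh_fn l"]
        norm_walsh_fn[of k, where 'k = 'k] norm_walsh_fn[of l, where 'k = 'k] by linarith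
    ultimately have "1 / 2 \<le> C * norm (?U (B ?f))"
      using B(2) by linarith
    also have "\<dots> \<le> (C + 1) * norm (?U (B ?f))"
      by (intro mult_right_mono) auto
    finally have "2 * \<delta> \<le> norm (?U (B ?f))"
      using \<open>0 \<le> C\<close> by (simp add: \<delta>_def field_simps)
    then have "\<not> norm (?U (B ?f)) \<le> \<delta>"
      using \<delta> by linarith
    then have "\<not> (\<forall>x\<in>(\<Union>m\<in>M'. E m). norm (coef x (B ?f)) \<le> \<delta>)"
      using norm_walsh_op_le[of "\<Union>m\<in>M'. E m" "B ?f" \<delta>] \<delta> by (meson less_imp_le)
    then show ?thesis
      using B(1) by (metis less_imp_le not_le)
  qed
  obtain Z and q :: "'k \<Rightarrow> 'k" where q: "finite Z" "\<And>z. norm z \<le> \<beta> \<Longrightarrow> q z \<in> Z" "\<And>z. norm z \<le> \<beta> \<Longrightarrow> norm (z - q z) < \<delta> / 2"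
    using finite_quantization[of "\<delta> / 2" \<beta>, where 'b = 'k] \<delta> by (metis half_gt_zero)
  obtain c :: nat where c: "8 * (real DIM('k) * \<beta> / \<delta>)\<^sup>2 \<le> real c"
    using real_arch_simple by blast
  obtain s :: nat where s: "real (card \<B>) * (\<beta> / (\<delta> / 2))\<^sup>2 \<le> real s"
    using real_arch_simple by blast
  obtain N where N: "\<And>n d. N \<le> n \<Longrightarrow> n \<le> d \<Longrightarrow> c * (d + 2) + 1 \<le> 2 ^ d \<and>
      ((d * card \<B> + card \<B> * (c * (d + 2))) * card Z + 1) ^ s < d ^ n"
    using block_size_wins[of c "card \<B>" "card Z" s] by blast
  obtain n where n: "N \<le> n" "n \<in> M" "n \<notin> M'"
    using assms unfolding infinite_nat_iff_unbounded_le by blast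
  have "n \<le> D (Suc n)"
    using D_Suc[of n] by linarith
  note Nn = N[OF n(1) this]
  have "card (E n) \<le> ((D (Suc n) * card \<B> + card \<B> * (c * (D (Suc n) + 2))) * card Z + 1) ^ s"
    using card_block_le[OF n(3) \<B> \<delta> \<open>0 < \<beta>\<close> \<beta> c conjunct1[OF Nn] s sep[OF n(2)] q] by simp
  also have "\<dots> < D (Suc n) ^ n"
    by (rule conjunct2[OF Nn])
  also have "\<dots> \<le> card (E n)"
    by (rule card_E)
  finally show False by simp
qed

end

lemma small_closed_ideal_walsh:
  "small_closed_ideal (dominated_ideal (walsh_op A :: 'k::{real_normed_field, euclidean_space} cantor_op))"
proof -
  have carrier: "(walsh_op A :: 'k cantor_op) \<in> carrier L_C_cantor"
    by (simp add: in_carrier_L_iff walsh_op_pointwise_scale)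
  have "(norm (walsh_op A g))\<^sup>2 \<le> (LINT s|haar. (norm (g s))\<^sup>2)" for g :: "cantor \<Rightarrow>\<^sub>C 'k"
  proof -
    have nonneg: "0 \<le> (LINT s|haar. (norm (g s))\<^sup>2)"
      by (rule Bochner_Integration.integral_nonneg) simp
    have "norm (walsh_op A g) \<le> sqrt (LINT s|haar. (norm (g s))\<^sup>2)"
      by (rule norm_walsh_op_le) (simp_all add: real_le_rsqrt norm_coef_le_L2 nonneg)
    then have "(norm (walsh_op A g))\<^sup>2 \<le> (sqrt (LINT s|haar. (norm (g s))\<^sup>2))\<^sup>2"
      by (rule power_mono) simp
    then show ?thesis using nonneg by simp
  qed
  then show ?thesis
    unfolding small_closed_ideal_def
    using ideal_dominated_ideal[OF carrier] closedin_dominated_ideal strictly_singular_dominated by blast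
qed

text \<open>
  A family of infinite sets of naturals with the property that two different members have only finitely many
  elements in common.
\<close>

definition prefixes :: "nat set \<Rightarrow> nat set" where
  "prefixes A = range (\<lambda>n. prod_encode (n, set_encode (A \<inter> {..<n})))"

lemma infinite_prefixes_diff:
  assumes "A \<noteq> B"
  shows "infinite (prefixes A - prefixes B)"
proof -
  obtain i where i: "i \<in> A \<longleftrightarrow> i \<notin> B" using assms by blast
  let ?c = "\<lambda>n. prod_encode (n, set_encode (A \<inter> {..<n}))"
  have "?c ` {i<..} \<subseteq> prefixes A - prefixes B"
  proof
    fix m assume "m \<in> ?c ` {i<..}"
    then obtain n where n: "i < n" "m = ?c n" by auto
    have "A \<inter> {..<n} \<noteq> B \<inter> {..<n}"
      using i n(1) by blast
    then have "set_encode (A \<inter> {..<n}) \<noteq> set_encode (B \<inter> {..<n})"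
      by (simp add: set_encode_eq)
    then have "m \<notin> prefixes B"
      using n(2) by (auto simp: prefixes_def)
    then show "m \<in> prefixes A - prefixes B"
      using n(2) by (auto simp: prefixes_def)
  qed
  moreover have "infinite (?c ` {i<..})"
    by (subst finite_image_iff) (auto simp: inj_on_def infinite_Ioi)
  ultimately show ?thesis
    using finite_subset by blast
qed

lemma continuum_of_small_closed_ideals:
  "\<exists>\<J> :: 'k::{real_normed_field, euclidean_space} cantor_op set set.
     \<J> \<approx> (UNIV :: nat set set) \<and> (\<forall>J\<in>\<J>. small_closed_ideal J)"
proof -
  obtain D E where "walsh_blocks D E"
    using blocks_exist unfolding walsh_blocks_def by metis
  then interpret walsh_blocks D E .
  define I where "I A = dominated_ideal (walsh_op (\<Union>n\<in>prefixes A. E n) :: 'k cantor_op)" for A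
  have "inj I"
  proof (rule injI, rule ccontr)
    fix A B assume "I A = I B" "A \<noteq> B"
    have "walsh_op (\<Union>n\<in>prefixes A. E n) \<in> I A"
      unfolding I_def
      by (intro generator_in_dominated_ideal) (simp add: in_carrier_L_iff walsh_op_pointwise_scale)
    moreover have "walsh_op (\<Union>n\<in>prefixes A. E n) \<notin> I B"
      unfolding I_def by (intro walsh_op_not_dominated infinite_prefixes_diff \<open>A \<noteq> B\<close>)
    ultimately show False
      using \<open>I A = I B\<close> by simp
  qed
  then have "range I \<approx> (UNIV :: nat set set)"
    by (rule inj_on_image_eqpoll_self)
  then show ?thesis
    using small_closed_ideal_walsh unfolding I_def by (intro exI[of _ "range I"]) (auto simp: I_def)
qed

theorem corollary3p2:
  shows "(\<exists>\<J> :: real cantor_op set set.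
            \<J> \<approx> (UNIV :: nat set set) \<and> (\<forall>J\<in>\<J>. small_closed_ideal J)) \<and>
         (\<exists>\<J> :: complex cantor_op set set.
            \<J> \<approx> (UNIV :: nat set set) \<and> (\<forall>J\<in>\<J>. small_closed_ideal J))"
  by (intro conjI continuum_of_small_closed_ideals)

end
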